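(* Assume that $f^\star:[0,1]^d\to\mathbb{R}$ is $L$-Lipschitz continuous and that the additive noise $\varepsilon$ is a centered Gaussian variable, independent of $X$, with finite variance $\sigma^2$. Let $d>5$. Then there is a constant $C_d>0$, not depending on $n$ (it may depend on $\sigma^2$, $d$ and $\|f^\star\|_\infty$), such that the excess risk of the infinite centered KeRF of depth $k_n=\lfloor\log_2 n\rfloor$ satisfies, for all $n$ large enough, $$\mathcal{R}\big(f^{\mathrm{KeRF}}_{\infty,n}\big)\le 8L^2d^2\,n^{2\log_2\left(1-\frac1d\right)}+C_d\,(\log_2 n)^{-\frac{d-5}{6}}\,\big(\log_2(\log_2 n)\big)^{d/3}.$$
   Context: Regression setting: $X$ is uniform on $[0,1]^d$ and $Y=f^\star(X)+\varepsilon$. The training set $\mathcal{D}_n=((X_1,Y_1),\dots,(X_n,Y_n))$ consists of i.i.d. copies of $(X,Y)$, independent of $(X,Y)$. The excess risk of an estimator $f_n$ is $\mathcal{R}(f_n)=\mathbb{E}[(f_n(X)-f^\star(X))^2]$. Centered tree of depth $k$: starting from the root cell $[0,1]^d$, for $k$ successive levels every cell is split at the middle of its side along a coordinate direction chosen uniformly at random in $\{1,\dots,d\}$ (choices independent across cells and independent of the data; $\Theta$ denotes all these random choices). $A_n(x,\Theta)$ denotes the leaf containing $x$. Infinite centered kernel random forest (KeRF) of depth $k_n$: $$f^{\mathrm{KeRF}}_{\infty,n}(x)=\frac{\sum_{i=1}^nY_iK_n(x,X_i)}{\sum_{i=1}^nK_n(x,X_i)},\qquad K_n(x,z)=\mathbb{P}_\Theta\big[z\in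 A_n(x,\Theta)\big],$$ where $K_n(x,z)$ is the probability, over $\Theta$, that $x$ and $z$ lie in the same leaf of a centered tree of depth $k_n$, with the convention $0/0=0$. *)

theory Defs
  imports "HOL-Probability.Probability"
begin

text \<open>
  The outcome of the random choices of a centered tree is a full binary tree whose
  inner nodes carry the split directions.  The split direction of each cell is uniform, and
  drawing both subtrees by separate binds makes the choices independent across cells.
\<close>

datatype 'd centered_tree = Leaf | Split 'd "'d centered_tree" "'d centered_tree"

primrec centered_tree_pmf :: "nat \<Rightarrow> 'd::finite centered_tree pmf" where
  "centered_tree_pmf 0 = return_pmf Leaf"
| "centered_tree_pmf (Suc k) =
     bind_pmf (pmf_of_set UNIV) (\<lambda>j.
     bind_pmf (centered_tree_pmf k) (\<lambda>s.
     bind_pmf (centered_tree_pmf k) (\<lambda>t.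
     return_pmf (Split j s t))))"

text \<open>
  In \<open>leaf_in \<theta> l u A x\<close>, the current cell is \<open>A\<close>, with lower corner \<open>l\<close> and upper corner
  \<open>u\<close>; the result is the leaf containing \<open>x\<close>.  Points on a splitting hyperplane (a null set) are
  assigned to the upper half, so that the leaves partition the root cell.
\<close>

primrec leaf_in :: "'d::finite centered_tree \<Rightarrow> real^'d \<Rightarrow> real^'d \<Rightarrow> (real^'d) set
    \<Rightarrow> real^'d \<Rightarrow> (real^'d) set" where
  "leaf_in Leaf l u A x = A"
| "leaf_in (Split j s t) l u A x =
     (let m = (l $ j + u $ j) / 2 in
      if x $ j < m
      then leaf_in s l (\<chi> i. if i = j then m else u $ i) (A \<inter> {y. y $ j < m}) x
      else leaf_in t (\<chi> i. if i = j then m else l $ i) u (A \<inter> {y. m \<le> y $ j}) x)"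

definition leaf_cell :: "real^'d::finite \<Rightarrow> 'd centered_tree \<Rightarrow> (real^'d) set" where
  "leaf_cell x \<theta> = leaf_in \<theta> 0 1 (cbox 0 1) x"

definition kerf_kernel :: "nat \<Rightarrow> real^'d::finite \<Rightarrow> real^'d \<Rightarrow> real" where
  "kerf_kernel k x z = measure_pmf.prob (centered_tree_pmf k) {\<theta>. z \<in> leaf_cell x \<theta>}"

text \<open>
  The infinite KeRF of depth \<open>k\<close> built on the data \<open>(xs i, ys i)\<close>, \<open>1 \<le> i \<le> n\<close>.  The
  convention \<open>0 / 0 = 0\<close> is that of HOL division.
\<close>

definition infinite_kerf ::
    "nat \<Rightarrow> nat \<Rightarrow> (nat \<Rightarrow> real^'d::finite) \<Rightarrow> (nat \<Rightarrow> real) \<Rightarrow> real^'d \<Rightarrow> real" where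
  "infinite_kerf k n xs ys x =
     (\<Sum>i=1..n. ys i * kerf_kernel k x (xs i)) / (\<Sum>i=1..n. kerf_kernel k x (xs i))"

text \<open>
  Independence of two random variables with possibly different value types (the
  library's \<open>indep_var\<close> requires equal ones).
\<close>

definition independent_rvs ::
    "'w measure \<Rightarrow> 'a measure \<Rightarrow> ('w \<Rightarrow> 'a) \<Rightarrow> 'b measure \<Rightarrow> ('w \<Rightarrow> 'b) \<Rightarrow> bool" where
  "independent_rvs M N1 A N2 B \<longleftrightarrow>
     A \<in> measurable M N1 \<and> B \<in> measurable M N2 \<and>
     prob_space.indep_set M {A -` S \<inter> space M | S. S \<in> sets N1} {B -` S \<inter> space M | S. S \<in> sets N2}"

text \<open>The law \<open>N(0, \<sigma>\<^sup>2)\<close>, which is the Dirac mass at 0 when \<open>\<sigma> = 0\<close>.\<close>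

definition centered_gaussian :: "'w measure \<Rightarrow> real \<Rightarrow> ('w \<Rightarrow> real) \<Rightarrow> bool" where
  "centered_gaussian M \<sigma> E \<longleftrightarrow>
     (if \<sigma> = 0 then E \<in> borel_measurable M \<and> (AE \<omega> in M. E \<omega> = 0)
      else distributed M lborel E (normal_density 0 \<sigma>))"

text \<open>
  The regression function is only relevant on the cube, so \<open>X\<close> is required to take its
  values there surely and not just almost surely.
\<close>

definition regression_model ::
    "'w measure \<Rightarrow> (real^'d::finite \<Rightarrow> real) \<Rightarrow> real \<Rightarrow> ('w \<Rightarrow> real^'d) \<Rightarrow> ('w \<Rightarrow> real)
     \<Rightarrow> ('w \<Rightarrow> real) \<Rightarrow> bool" where
  "regression_model M f \<sigma> X E Y \<longleftrightarrow>
     prob_space M \<and>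
     X \<in> space M \<rightarrow> cbox 0 1 \<and>
     distr M borel X = uniform_measure lborel (cbox 0 1) \<and>
     centered_gaussian M \<sigma> E \<and>
     independent_rvs M borel X borel E \<and>
     (\<forall>\<omega>\<in>space M. Y \<omega> = f (X \<omega>) + E \<omega>)"

definition training_set ::
    "'w measure \<Rightarrow> nat \<Rightarrow> ('w \<Rightarrow> real^'d::finite) \<Rightarrow> ('w \<Rightarrow> real)
     \<Rightarrow> (nat \<Rightarrow> 'w \<Rightarrow> real^'d) \<Rightarrow> (nat \<Rightarrow> 'w \<Rightarrow> real) \<Rightarrow> bool" where
  "training_set M n X Y Xs Ys \<longleftrightarrow>
     prob_space.indep_vars M (\<lambda>_. borel \<Otimes>\<^sub>M borel) (\<lambda>i \<omega>. (Xs i \<omega>, Ys i \<omega>)) {1..n} \<and>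
     (\<forall>i\<in>{1..n}. distr M (borel \<Otimes>\<^sub>M borel) (\<lambda>\<omega>. (Xs i \<omega>, Ys i \<omega>)) =
                 distr M (borel \<Otimes>\<^sub>M borel) (\<lambda>\<omega>. (X \<omega>, Y \<omega>))) \<and>
     independent_rvs M
       (Pi\<^sub>M {1..n} (\<lambda>_. borel \<Otimes>\<^sub>M borel)) (\<lambda>\<omega>. \<lambda>i\<in>{1..n}. (Xs i \<omega>, Ys i \<omega>))
       (borel \<Otimes>\<^sub>M borel) (\<lambda>\<omega>. (X \<omega>, Y \<omega>))"

text \<open>
  Here \<open>F \<omega>\<close> is the estimator computed from the data set at \<open>\<omega>\<close>, and \<open>X\<close> is the
  independent test point.
\<close>

definition squared_error ::
    "(real^'d \<Rightarrow> real) \<Rightarrow> ('w \<Rightarrow> real^'d) \<Rightarrow> ('w \<Rightarrow> real^'d \<Rightarrow> real) \<Rightarrow> 'w \<Rightarrow> real" where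
  "squared_error f X F \<omega> = (F \<omega> (X \<omega>) - f (X \<omega>))\<^sup>2"

definition excess_risk ::
    "'w measure \<Rightarrow> (real^'d \<Rightarrow> real) \<Rightarrow> ('w \<Rightarrow> real^'d) \<Rightarrow> ('w \<Rightarrow> real^'d \<Rightarrow> real) \<Rightarrow> real" where
  "excess_risk M f X F = prob_space.expectation M (squared_error f X F)"

end

theory Submission
  imports Defs "HOL-Real_Asymp.Real_Asymp"
begin

text \<open>The depth \<open>k = \<lfloor>log 2 n\<rfloor>\<close> is the obstacle: the mean
  \<open>c = n / 2 ^ k\<close> of the kernel sum lies between 1 and 2, so a leaf of a single tree
  holds about one data point and its count does not concentrate. Concentration can only come from
  averaging over trees. Relative to its mean, the kernel sum has variance at most (E K^2) / (n (E
  K)^2), and as E K = 2^-k this is the ratio E K^2 / E K divided by \<open>c\<close>. That ratio is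
  bounded by \<open>kernel_decay\<close>, which tends to 0 because two independently drawn
  multinomial count vectors are rarely close to each other.

  The bias is estimated through squared diameters of boxes. This gives the rate (1 - 3/(4d))^k,
  slower than (1 - 1/d)^(2k), so the bias is charged to the logarithmic term of the claim. It
  carries a factor L^2 while the constant must not depend on L; exponential decay resolves this, as
  the bias falls below the logarithmic term once n exceeds a threshold depending on L.\<close>

text \<open>
  A leaf of a centered tree is a product of dyadic intervals, and the numbers of splits along
  the coordinates are multinomial. Hence the kernel \<open>K\<close> of depth \<open>k\<close> is an average, over a multinomial
  vector \<open>m\<close>, of indicators of dyadic boxes of volume \<open>2\<^sup>-\<^sup>k\<close>. Two such boxes given by \<open>m\<close> and \<open>m'\<close>
  meet in volume \<open>2\<^sup>-\<^sup>k 2\<^bsup>- |m - m'| / 2\<^esup>\<close>, so that \<open>E K\<^sup>2\<close> is at most \<open>2\<^sup>-\<^sup>k\<close> times a constant times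
  the largest multinomial probability, which is of order \<open>k\<close> to the power \<open>- (d - 1) / 2\<close>.

  By Chebyshev the denominator of the estimator is therefore at least half its mean up to an event
  whose probability has that order. On this event the estimator is still a weighted average,
  so its error stays bounded in mean square. Off the event the noise contributes
  \<open>\<sigma>\<^sup>2 \<Sum> w\<^sub>i\<^sup>2\<close>, controlled by \<open>E K\<^sup>2\<close>, and the bias decays exponentially in \<open>k\<close>.
  The total is of smaller order than the claimed logarithmic term.
\<close>

section \<open>Multinomial averages\<close>

text \<open>
  The expectation of \<open>h m\<close>, where \<open>m\<close> counts the splits along each coordinate on a branch of length \<open>k\<close>.
\<close>

primrec split_avg :: "nat \<Rightarrow> (('d::finite \<Rightarrow> nat) \<Rightarrow> real) \<Rightarrow> real" where
  "split_avg 0 h = h (\<lambda>_. 0)"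
| "split_avg (Suc k) h = (\<Sum>j\<in>UNIV. split_avg k (\<lambda>m. h (m(j := Suc (m j))))) / CARD('d)"

lemma sum_fun_upd_Suc: "(\<Sum>i\<in>UNIV. (m(j := Suc (m j))) i) = Suc (\<Sum>i\<in>UNIV. m i)"
  for m :: "'d::finite \<Rightarrow> nat"
proof -
  have "(\<Sum>i\<in>UNIV. (m(j := Suc (m j))) i) = Suc (m j) + (\<Sum>i\<in>UNIV - {j}. m i)"
    by (subst sum.remove[of _ j]) auto
  also have "\<dots> = Suc (\<Sum>i\<in>UNIV. m i)"
    by (subst (2) sum.remove[of _ j]) auto
  finally show ?thesis .
qed

lemma split_avg_mono:
  assumes "\<And>m. sum m UNIV = k \<Longrightarrow> g m \<le> h m"
  shows "split_avg k g \<le> split_avg k h"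
  using assms
proof (induction k arbitrary: g h)
  case (Suc k)
  show ?case
    by (auto intro!: divide_right_mono sum_mono Suc simp del: fun_upd_apply simp: sum_fun_upd_Suc)
qed simp

lemma split_avg_cong:
  assumes "\<And>m. sum m UNIV = k \<Longrightarrow> g m = h m"
  shows "split_avg k g = split_avg k h"
  using assms by (intro antisym split_avg_mono) simp_all

lemma split_avg_const [simp]: "split_avg k (\<lambda>_. c) = c"
  by (induction k) auto

lemma split_avg_nonneg:
  assumes "\<And>m. sum m UNIV = k \<Longrightarrow> 0 \<le> h m"
  shows "0 \<le> split_avg k h"
  using split_avg_mono[of k "\<lambda>_. 0" h] assms by simp

lemma split_avg_cmult: "split_avg k (\<lambda>m. c * h m) = c * split_avg k h"
  by (induction k arbitrary: h) (simp_all add: sum_distrib_left)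

lemma split_avg_sum: "split_avg k (\<lambda>m. \<Sum>i\<in>I. h i m) = (\<Sum>i\<in>I. split_avg k (h i))"
proof (induction k arbitrary: h)
  case (Suc k)
  show ?case
    unfolding split_avg.simps Suc sum_divide_distrib[symmetric] by (subst sum.swap) simp
qed simp

lemma split_avg_measurable [measurable]:
  assumes "\<And>m. h m \<in> borel_measurable N"
  shows "(\<lambda>z. split_avg k (\<lambda>m. h m z)) \<in> borel_measurable N"
  using assms
proof (induction k arbitrary: h)
  case (Suc k)
  have [measurable]: "(\<lambda>z. split_avg k (\<lambda>m. h (m(j := Suc (m j))) z)) \<in> borel_measurable N" for j
    by (rule Suc.IH) (rule Suc.prems)
  show ?case unfolding split_avg.simps by measurable
qed simp

lemma split_avg_integral:
  assumes "\<And>m. integrable N (h m)"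
  shows "integrable N (\<lambda>z. split_avg k (\<lambda>m. h m z))"
    and "(\<integral>z. split_avg k (\<lambda>m. h m z) \<partial>N) = split_avg k (\<lambda>m. \<integral>z. h m z \<partial>N)"
proof -
  have "integrable N (\<lambda>z. split_avg k (\<lambda>m. h m z)) \<and>
     (\<integral>z. split_avg k (\<lambda>m. h m z) \<partial>N) = split_avg k (\<lambda>m. \<integral>z. h m z \<partial>N)"
    using assms
  proof (induction k arbitrary: h)
    case (Suc k)
    have *: "integrable N (\<lambda>z. split_avg k (\<lambda>m. h (m(j := Suc (m j))) z)) \<and>
      (\<integral>z. split_avg k (\<lambda>m. h (m(j := Suc (m j))) z) \<partial>N)
        = split_avg k (\<lambda>m. \<integral>z. h (m(j := Suc (m j))) z \<partial>N)" for j
      by (rule Suc.IH) (rule Suc.prems)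
    show ?case using * by simp
  qed simp
  then show "integrable N (\<lambda>z. split_avg k (\<lambda>m. h m z))"
    and "(\<integral>z. split_avg k (\<lambda>m. h m z) \<partial>N) = split_avg k (\<lambda>m. \<integral>z. h m z \<partial>N)"
    by auto
qed

text \<open>The generating function of a binomial count: each of the \<open>k\<close> draws
  independently contributes the factor \<open>a\<close> with probability 1/d and the factor 1
  otherwise.\<close>

lemma split_avg_power:
  "split_avg k (\<lambda>m. a ^ m j) = (1 - (1 - a) / CARD('d)) ^ k" for j :: "'d::finite"
proof (induction k)
  case (Suc k)
  have "split_avg (Suc k) (\<lambda>m. a ^ m j)
      = (\<Sum>i\<in>UNIV. split_avg k (\<lambda>m. (if i = j then a else 1) * a ^ m j)) / CARD('d)"
    unfolding split_avg.simps
    by (intro arg_cong2[of _ _ _ _ "(/)"] sum.cong refl split_avg_cong) auto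
  also have "\<dots> = (\<Sum>i\<in>UNIV. if i = j then a else 1) * split_avg k (\<lambda>m. a ^ m j) / CARD('d)"
    by (simp only: split_avg_cmult sum_distrib_right)
  also have "(\<Sum>i\<in>UNIV. if i = j then a else 1) = (CARD('d) - 1) + a"
    by (subst sum.remove[of _ j]) (auto simp: card_Diff_singleton of_nat_diff)
  finally show ?case by (simp add: Suc field_simps)
qed simp

section \<open>Multinomial point probabilities and the largest of them\<close>

lemma split_avg_point:
  fixes v :: "'d::finite \<Rightarrow> nat"
  assumes "sum v UNIV = k"
  shows "split_avg k (\<lambda>m. of_bool (m = v)) = fact k / ((\<Prod>j\<in>UNIV. fact (v j)) * real CARD('d) ^ k)"
  using assms
proof (induction k arbitrary: v)
  case 0
  then have "v = (\<lambda>_. 0)" by auto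
  then show ?case by simp
next
  case (Suc k)
  \<comment> \<open>Given that one draw is \<open>j\<close>, the remaining counts are
    \<open>v\<close> lowered by one at \<open>j\<close>, which divides the product of factorials by
    \<open>v j\<close>. Writing this as a factor \<open>v j\<close> in the numerator also covers
    \<open>v j = 0\<close>, and these factors add up to \<open>Suc k\<close>.\<close>
  have step: "split_avg k (\<lambda>m. of_bool (m(j := Suc (m j)) = v))
      = fact k * real (v j) / ((\<Prod>j\<in>UNIV. fact (v j)) * real CARD('d) ^ k)" for j
  proof (cases "v j")
    case 0
    then have "(m(j := Suc (m j)) = v) = False" for m
      by (metis fun_upd_same nat.distinct(1))
    then show ?thesis using 0 by simp
  next
    case (Suc r)
    let ?u = "v(j := r)"
    have v: "v = ?u(j := Suc (?u j))" using Suc by auto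
    have eq: "(m(j := Suc (m j)) = v) = (m = ?u)" for m
      using Suc by (auto simp: fun_eq_iff)
    have "sum v UNIV = Suc (sum ?u UNIV)"
      using arg_cong[OF v, of "\<lambda>v. sum v UNIV"] unfolding sum_fun_upd_Suc .
    then have "sum ?u UNIV = k" using Suc.prems by simp
    from Suc.IH[OF this] have A: "split_avg k (\<lambda>m. of_bool (m(j := Suc (m j)) = v))
      = fact k / ((\<Prod>j\<in>UNIV. fact (?u j)) * real CARD('d) ^ k)"
      unfolding eq .
    have B: "(\<Prod>j\<in>UNIV. fact (v j)) = v j * (\<Prod>j\<in>UNIV. fact (?u j) :: real)"
      by (subst (1 2) prod.remove[of _ j]) (auto simp: Suc)
    have cancel: "x / y = real (v j) * x / (real (v j) * y)" for x y
      using Suc by (subst mult_divide_mult_cancel_left) auto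
    show ?thesis unfolding A B
      by (subst cancel) (simp only: mult_ac)
  qed
  have "split_avg (Suc k) (\<lambda>m. of_bool (m = v))
     = fact k * (\<Sum>j\<in>UNIV. real (v j)) / ((\<Prod>j\<in>UNIV. fact (v j)) * real CARD('d) ^ k) / CARD('d)"
    unfolding split_avg.simps step sum_distrib_left sum_divide_distrib ..
  also have "(\<Sum>j\<in>UNIV. real (v j)) = Suc k"
    unfolding Suc.prems[symmetric] by (rule of_nat_sum[symmetric])
  finally show ?case by (simp add: field_simps)
qed

lemma split_avg_point_outside:
  fixes v :: "'d::finite \<Rightarrow> nat"
  assumes "sum v UNIV \<noteq> k"
  shows "split_avg k (\<lambda>m. of_bool (m = v)) = 0"
proof -
  have "split_avg k (\<lambda>m. of_bool (m = v)) = split_avg k (\<lambda>m :: 'd \<Rightarrow> nat. 0)"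
    by (rule split_avg_cong) (use assms in auto)
  then show ?thesis by simp
qed

text \<open>The Poisson weight q^b / b! with parameter q is largest at b = q: consecutive weights
  have ratio q / (b + 1). The induction runs away from b = q in both directions.\<close>

lemma fact_ge_power:
  assumes "0 < q"
  shows "fact q * real q ^ b \<le> fact b * real q ^ q"
proof (cases "q \<le> b")
  case True
  then show ?thesis
  proof (induction b rule: dec_induct)
    case (step c)
    have "fact q * real q ^ Suc c = real q * (fact q * real q ^ c)" by simp
    also have "\<dots> \<le> Suc c * (fact c * real q ^ q)"
      by (rule mult_mono) (use step in auto)
    finally show ?case by (simp add: algebra_simps)
  qed simp
next
  case False
  then have "b \<le> q" by simp
  then show ?thesis
  proof (induction b rule: inc_induct)
    case (step c)
    have "real q * (fact q * real q ^ c) = fact q * real q ^ Suc c" by simp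
    also have "\<dots> \<le> real (Suc c) * (fact c * real q ^ q)"
      using step.IH by (simp add: algebra_simps)
    also have "\<dots> \<le> q * (fact c * real q ^ q)"
      by (rule mult_right_mono) (use step in auto)
    finally show ?case using assms by simp
  qed simp
qed

text \<open>The balanced vector minimises the product of factorials, hence maximises the multinomial
  probability. In the product of the previous inequality over the coordinates, the powers of
  \<open>q\<close> have total exponent d q on both sides and cancel.\<close>

lemma fact_prod_ge:
  fixes v :: "'d::finite \<Rightarrow> nat"
  assumes "sum v UNIV = CARD('d) * q"
  shows "(fact q :: real) ^ CARD('d) \<le> (\<Prod>j\<in>UNIV. fact (v j))"
proof (cases "q = 0")
  case False
  have "(\<Prod>j\<in>(UNIV::'d set). fact q * real q ^ v j) \<le> (\<Prod>j\<in>UNIV. fact (v j) * real q ^ q)"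
    using False by (intro prod_mono) (auto intro!: fact_ge_power)
  then have "fact q ^ CARD('d) * real q ^ (CARD('d) * q)
      \<le> (\<Prod>j\<in>UNIV. fact (v j)) * real q ^ (CARD('d) * q)"
    using assms by (simp add: prod.distrib flip: power_sum power_mult) (simp add: mult.commute)
  then show ?thesis using False by simp
next
  case True
  have "1 \<le> (\<Prod>j\<in>UNIV. fact (v j) :: real)" by (intro prod_ge_1) (auto simp: fact_ge_1)
  then show ?thesis using True by simp
qed

text \<open>
  The quotient of consecutive terms is a product of factors \<open>1 - i / (d (q + 1))\<close>, \<open>0 \<le> i < d\<close>, at most
  \<open>exp (- (d - 1) / (2 (q + 1)))\<close>; this replaces Stirling's formula.
\<close>

lemma fact_multiple_le:
  fixes d :: nat
  assumes "0 < d"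
  shows "fact (d * q) / (fact q ^ d * real d ^ (d * q)) \<le> real (Suc q) powr (- ((real d - 1) / 2))"
proof (induction q)
  case (Suc q)
  define D where "D = real d"
  have D: "D > 0" using assms by (simp add: D_def)
  let ?P = "\<lambda>q. fact (d * q) / (fact q ^ d * real d ^ (d * q)) :: real"
  have f: "fact (n + r) = fact n * (\<Prod>i=1..r. real (n + i))" for n r
    by (induction r) (simp_all add: algebra_simps)
  have "fact (d * Suc q) = fact (d * q) * (\<Prod>i=1..d. real (d * q + i))"
    using f[of "d * q" d] by (simp add: add.commute)
  then have "?P (Suc q) / ?P q = ((\<Prod>i=1..d. real (d * q + i)) / (real (Suc q) ^ d * real d ^ d))"
    using assms by (simp add: power_mult_distrib power_add)
  also have "(\<Prod>i=1..d. real (d * q + i)) / (real (Suc q) ^ d * real d ^ d)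
      = (\<Prod>i=1..d. real (d * q + i) / (real d * real (Suc q)))"
    by (simp add: prod_dividef power_mult_distrib mult.commute)
  also have "\<dots> \<le> (\<Prod>i=1..d. exp ((real i - D) / (D * Suc q)))"
  proof (intro prod_mono conjI)
    fix i assume "i \<in> {1..d}"
    have "real (d * q + i) / (real d * real (Suc q)) = (D * Suc q + (real i - D)) / (D * Suc q)"
      by (simp add: D_def algebra_simps)
    also have "\<dots> = 1 + (real i - D) / (D * Suc q)"
      using D by (subst add_divide_distrib) simp
    also have "\<dots> \<le> exp ((real i - D) / (D * Suc q))" by (rule exp_ge_add_one_self)
    finally show "real (d * q + i) / (real d * real (Suc q)) \<le> exp ((real i - D) / (D * Suc q))" .
  qed simp
  also have "\<dots> = exp (\<Sum>i=1..d. (real i - D) / (D * Suc q))" by (simp add: exp_sum)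
  also have "(\<Sum>i=1..d. (real i - D) / (D * Suc q)) = (\<Sum>i=1..d. real i - D) / (D * Suc q)"
    by (simp add: sum_divide_distrib)
  also have "(\<Sum>i=1..d. real i - D) = - (D * (D - 1) / 2)"
  proof -
    have "(\<Sum>i=1..d. real i) = D * (D + 1) / 2"
      unfolding D_def by (induction d) (auto simp: field_simps)
    then show ?thesis by (simp add: sum_subtractf D_def[symmetric] field_simps)
  qed
  also have "- (D * (D - 1) / 2) / (D * Suc q) = (D * (- ((D - 1) / 2))) / (D * Suc q)"
    by simp
  also have "\<dots> = - ((D - 1) / 2) * (1 / Suc q)"
    using D by (subst mult_divide_mult_cancel_left) auto
  \<comment> \<open>By ln (1 + t) \<le> t with t = 1 / (q + 1), the exponential is at most a ratio
    of consecutive powers, so the bound telescopes along the induction.\<close>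
  also have "exp \<dots> \<le> exp (- ((D - 1) / 2) * ln (Suc (Suc q) / Suc q))"
  proof -
    have "ln (real (Suc (Suc q)) / Suc q) = ln (1 + 1 / real (Suc q))" by (simp add: field_simps)
    also have "\<dots> \<le> 1 / real (Suc q)" by (rule ln_add_one_self_le_self) simp
    finally show ?thesis
      unfolding exp_le_cancel_iff by (rule mult_left_mono_neg) (use assms in \<open>simp add: D_def\<close>)
  qed
  also have "\<dots> = (Suc (Suc q) / Suc q) powr (- ((D - 1) / 2))" by (simp add: powr_def)
  finally have "?P (Suc q) / ?P q \<le> (Suc (Suc q) / Suc q) powr (- ((D - 1) / 2))" .
  then have "?P (Suc q) \<le> ?P q * (Suc (Suc q) / Suc q) powr (- ((D - 1) / 2))"
    by (subst (asm) pos_divide_le_eq) (use assms in \<open>auto simp: mult.commute\<close>)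
  also have "\<dots> \<le> real (Suc q) powr (- ((D - 1) / 2)) * (Suc (Suc q) / Suc q) powr (- ((D - 1) / 2))"
    using Suc by (intro mult_right_mono) (auto simp: D_def)
  also have "\<dots> = real (Suc (Suc q)) powr (- ((D - 1) / 2))"
    by (subst powr_mult[symmetric]) auto
  finally show ?case by (simp add: D_def)
qed simp

text \<open>At multiples of d the maximum sits at the balanced vector. Each further draw turns a
  point probability into an average of earlier ones, so the maximum does not grow and the bound for
  the last multiple of d persists.\<close>

lemma split_avg_point_le:
  fixes v :: "'d::finite \<Rightarrow> nat"
  shows "split_avg k (\<lambda>m. of_bool (m = v)) \<le> real (Suc (k div CARD('d))) powr (- ((real CARD('d) - 1) / 2))"
proof -
  define q where "q = k div CARD('d)"
  define b where "b = real (Suc q) powr (- ((real CARD('d) - 1) / 2))"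
  have mult: "split_avg (CARD('d) * q) (\<lambda>m. of_bool (m = v)) \<le> b" for v :: "'d \<Rightarrow> nat"
  proof (cases "sum v UNIV = CARD('d) * q")
    case True
    have pos: "0 < (\<Prod>j\<in>(UNIV::'d set). fact (v j) :: real)" by (rule prod_pos) simp
    have "split_avg (CARD('d) * q) (\<lambda>m. of_bool (m = v))
        \<le> fact (CARD('d) * q) / (fact q ^ CARD('d) * real CARD('d) ^ (CARD('d) * q))"
      unfolding split_avg_point[OF True]
    proof (rule divide_left_mono)
      show "fact q ^ CARD('d) * real CARD('d) ^ (CARD('d) * q)
          \<le> (\<Prod>j\<in>UNIV. fact (v j)) * real CARD('d) ^ (CARD('d) * q)"
        by (rule mult_right_mono[OF fact_prod_ge[OF True]]) simp
    qed (use pos in simp_all)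
    also have "\<dots> \<le> b" unfolding b_def by (rule fact_multiple_le) simp
    finally show ?thesis .
  next
    case False
    then show ?thesis by (simp add: split_avg_point_outside b_def)
  qed
  have "split_avg (CARD('d) * q + r) (\<lambda>m. of_bool (m = v)) \<le> b" for r and v :: "'d \<Rightarrow> nat"
  proof (induction r arbitrary: v)
    case 0
    show ?case using mult[of v] by simp
  next
    case (Suc r)
    have "split_avg (CARD('d) * q + r) (\<lambda>m. of_bool (m(j := Suc (m j)) = v)) \<le> b" for j
    proof -
      \<comment> \<open>At most one \<open>m\<close> reaches \<open>v\<close> by a draw of
        \<open>j\<close>. For \<open>v j = 0\<close> there is none and truncated subtraction returns
        \<open>v\<close> itself, which is why only an implication is claimed.\<close>
      have "m = v(j := v j - 1)" if "m(j := Suc (m j)) = v" for m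
        using that by auto
      then have "split_avg (CARD('d) * q + r) (\<lambda>m. of_bool (m(j := Suc (m j)) = v))
        \<le> split_avg (CARD('d) * q + r) (\<lambda>m. of_bool (m = v(j := v j - 1)))"
        by (intro split_avg_mono) (simp only: of_bool_def split: if_splits, force)
      also have "\<dots> \<le> b" by (rule Suc.IH)
      finally show ?thesis .
    qed
    then have "(\<Sum>j\<in>(UNIV::'d set). split_avg (CARD('d) * q + r) (\<lambda>m. of_bool (m(j := Suc (m j)) = v)))
      \<le> (\<Sum>j\<in>(UNIV::'d set). b)"
      by (rule sum_mono)
    then have "(\<Sum>j\<in>(UNIV::'d set). split_avg (CARD('d) * q + r) (\<lambda>m. of_bool (m(j := Suc (m j)) = v)))
      \<le> b * CARD('d)" by (simp only: sum_constant mult.commute)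
    then show ?case unfolding add_Suc_right split_avg.simps
      by (rule pos_divide_le_eq[THEN iffD2, rotated]) simp
  qed
  from this[of "k mod CARD('d)" v] show ?thesis by (simp add: q_def b_def)
qed

section \<open>The kernel as an average over dyadic boxes\<close>

text \<open>One coordinate of a centered tree: \<open>x\<close> and \<open>z\<close> stay together
  through \<open>n\<close> halvings of the interval from \<open>a\<close> to \<open>b\<close>.
  Midpoints go to the upper half exactly as in \<open>leaf_in\<close>, so the later identity for the
  kernel holds at every point and not just almost everywhere.\<close>

primrec same_dyadic :: "nat \<Rightarrow> real \<Rightarrow> real \<Rightarrow> real \<Rightarrow> real \<Rightarrow> bool" where
  "same_dyadic 0 a b x z \<longleftrightarrow> True"
| "same_dyadic (Suc n) a b x z \<longleftrightarrow>
     (let c = (a + b) / 2 in (x < c \<and> z < c \<and> same_dyadic n a c x z)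
       \<or> (c \<le> x \<and> c \<le> z \<and> same_dyadic n c b x z))"

lemma same_dyadic_antimono:
  assumes "same_dyadic m a b x z" "n \<le> m"
  shows "same_dyadic n a b x z"
  using assms
proof (induction n arbitrary: m a b)
  case (Suc n)
  then obtain m' where "m = Suc m'" "n \<le> m'" by (cases m) auto
  with Suc show ?case by (auto simp: Let_def)
qed simp

text \<open>Dyadic cells around \<open>x\<close> are nested, so the intersection of two of them is
  the finer one. In the second moment this turns a product of two box indicators into a single
  one.\<close>

lemma same_dyadic_max: "same_dyadic (max m n) a b x z \<longleftrightarrow> same_dyadic m a b x z \<and> same_dyadic n a b x z"
  by (cases "m \<le> n") (auto simp: max_def intro: same_dyadic_antimono)

lemma same_dyadic_diff_le:
  assumes "same_dyadic n a b x z" "x \<in> {a..b}" "z \<in> {a..b}"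
  shows "\<bar>x - z\<bar> \<le> (b - a) / 2 ^ n"
  using assms
proof (induction n arbitrary: a b)
  case (Suc n)
  let ?c = "(a + b) / 2"
  from Suc.prems(1) consider "x < ?c" "z < ?c" "same_dyadic n a ?c x z"
    | "?c \<le> x" "?c \<le> z" "same_dyadic n ?c b x z"
    by (auto simp: Let_def)
  then show ?case
  proof cases
    case 1
    then have "\<bar>x - z\<bar> \<le> (?c - a) / 2 ^ n" using Suc.prems by (intro Suc.IH) auto
    then show ?thesis by (simp add: field_simps)
  next
    case 2
    then have "\<bar>x - z\<bar> \<le> (b - ?c) / 2 ^ n" using Suc.prems by (intro Suc.IH) auto
    then show ?thesis by (simp add: field_simps)
  qed
qed auto

text \<open>Enclosing the cell between an open and a closed interval with the same ends avoids
  tracking which ends belong to it; for volumes this is enough.\<close>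

lemma same_dyadic_interval:
  assumes "x \<in> {a..b}"
  shows "\<exists>l h. h - l = (b - a) / 2 ^ n \<and> a \<le> l \<and> h \<le> b \<and>
    {l<..<h} \<subseteq> {z. same_dyadic n a b x z} \<and> {z\<in>{a..b}. same_dyadic n a b x z} \<subseteq> {l..h}"
  using assms
proof (induction n arbitrary: a b)
  case 0
  then show ?case by (intro exI[of _ a] exI[of _ b]) auto
next
  case (Suc n)
  let ?c = "(a + b) / 2"
  show ?case
  proof (cases "x < ?c")
    case True
    then have "x \<in> {a..?c}" using Suc.prems by auto
    from Suc.IH[OF this] obtain l h where lh: "h - l = (?c - a) / 2 ^ n" "a \<le> l" "h \<le> ?c"
      "{l<..<h} \<subseteq> {z. same_dyadic n a ?c x z}"
      "{z\<in>{a..?c}. same_dyadic n a ?c x z} \<subseteq> {l..h}" by blast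
    show ?thesis
    proof (intro exI conjI)
      show "h - l = (b - a) / 2 ^ Suc n" using lh(1) by (simp add: field_simps)
      show "{l<..<h} \<subseteq> {z. same_dyadic (Suc n) a b x z}"
        using lh(3,4) True by (auto simp: Let_def)
      show "{z\<in>{a..b}. same_dyadic (Suc n) a b x z} \<subseteq> {l..h}"
      proof
        fix z assume "z \<in> {z\<in>{a..b}. same_dyadic (Suc n) a b x z}"
        then have "z \<in> {z\<in>{a..?c}. same_dyadic n a ?c x z}" using True by (auto simp: Let_def)
        then show "z \<in> {l..h}" using lh(5) by blast
      qed
    qed (use lh Suc.prems in auto)
  next
    case False
    then have "x \<in> {?c..b}" using Suc.prems by auto
    from Suc.IH[OF this] obtain l h where lh: "h - l = (b - ?c) / 2 ^ n" "?c \<le> l" "h \<le> b"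
      "{l<..<h} \<subseteq> {z. same_dyadic n ?c b x z}"
      "{z\<in>{?c..b}. same_dyadic n ?c b x z} \<subseteq> {l..h}" by blast
    show ?thesis
    proof (intro exI conjI)
      show "h - l = (b - a) / 2 ^ Suc n" using lh(1) by (simp add: field_simps)
      show "{l<..<h} \<subseteq> {z. same_dyadic (Suc n) a b x z}"
        using lh(2,4) False by (auto simp: Let_def)
      show "{z\<in>{a..b}. same_dyadic (Suc n) a b x z} \<subseteq> {l..h}"
      proof
        fix z assume "z \<in> {z\<in>{a..b}. same_dyadic (Suc n) a b x z}"
        then have "z \<in> {z\<in>{?c..b}. same_dyadic n ?c b x z}" using False by (auto simp: Let_def)
        then show "z \<in> {l..h}" using lh(5) by blast
      qed
    qed (use lh Suc.prems in auto)
  qed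
qed

lemma same_dyadic_measurable [measurable]:
  fixes f g :: "'a \<Rightarrow> real"
  assumes [measurable]: "f \<in> borel_measurable N" "g \<in> borel_measurable N"
  shows "Measurable.pred N (\<lambda>w. same_dyadic n a b (f w) (g w))"
proof (induction n arbitrary: a b)
  case (Suc n)
  note Suc[measurable]
  show ?case unfolding same_dyadic.simps Let_def by measurable
qed simp

abbreviation same_box :: "('d \<Rightarrow> nat) \<Rightarrow> real^'d::finite \<Rightarrow> real^'d \<Rightarrow> real^'d \<Rightarrow> real^'d \<Rightarrow> bool" where
  "same_box m l u x z \<equiv> \<forall>i. same_dyadic (m i) (l $ i) (u $ i) (x $ i) (z $ i)"

text \<open>The cell argument only accumulates intersections, so the induction on depth can be run
  with \<open>UNIV\<close> and arbitrary corners.\<close>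

lemma leaf_in_Int: "leaf_in \<theta> l u A x = A \<inter> leaf_in \<theta> l u UNIV x"
proof (induction \<theta> arbitrary: l u A)
  case (Split j s t)
  let ?m = "(l $ j + u $ j) / 2"
  show ?case
    by (simp add: Let_def Split(1)[of _ _ "_ \<inter> _"] Split(2)[of _ _ "_ \<inter> _"]
        Split(1)[of _ _ "Collect _"] Split(2)[of _ _ "Collect _"] Int_assoc)
qed simp

text \<open>The path to \<open>x\<close> enters only one subtree below each split and the other
  integrates to 1, so a single sequence of \<open>k\<close> uniform directions matters. Halvings in
  different coordinates do not interact, so only the number of splits per direction remains.\<close>

lemma emeasure_leaf_in:
  fixes x z l u :: "real^'d::finite"
  shows "emeasure (measure_pmf (centered_tree_pmf k)) {\<theta>. z \<in> leaf_in \<theta> l u UNIV x}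
     = ennreal (split_avg k (\<lambda>m. of_bool (same_box m l u x z)))"
proof (induction k arbitrary: l u)
  case 0
  then show ?case by (simp add: indicator_def)
next
  case (Suc k)
  let ?P = "measure_pmf (centered_tree_pmf k)"
  have step: "(\<integral>\<^sup>+s. \<integral>\<^sup>+t. indicator {\<theta>. z \<in> leaf_in \<theta> l u UNIV x} (Split j s t) \<partial>?P \<partial>?P)
     = ennreal (split_avg k (\<lambda>m. of_bool (same_box (m(j := Suc (m j))) l u x z)))" for j
  proof -
    define c where "c = (l $ j + u $ j) / 2"
    define l' where "l' = (\<chi> i. if i = j then c else l $ i)"
    define u' where "u' = (\<chi> i. if i = j then c else u $ i)"
    have "leaf_in (Split j s t) l u UNIV x =
        (if x $ j < c then leaf_in s l u' {y. y $ j < c} x else leaf_in t l' u {y. c \<le> y $ j} x)" for s t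
      by (simp only: leaf_in.simps Let_def c_def l'_def u'_def Int_UNIV_left)
    then have leaf: "z \<in> leaf_in (Split j s t) l u UNIV x \<longleftrightarrow>
        (x $ j < c \<and> z $ j < c \<and> z \<in> leaf_in s l u' UNIV x) \<or>
        (c \<le> x $ j \<and> c \<le> z $ j \<and> z \<in> leaf_in t l' u UNIV x)" for s t
      using leaf_in_Int[of s l u' "{y. y $ j < c}" x] leaf_in_Int[of t l' u "{y. c \<le> y $ j}" x]
      by auto
    \<comment> \<open>The root split is the first halving in coordinate \<open>j\<close>. It
      replaces one corner coordinate by the midpoint \<open>c\<close> and leaves the remaining
      counts \<open>m\<close> on the chosen half.\<close>
    have box: "same_box (m(j := Suc (m j))) l u x z \<longleftrightarrow>
        (x $ j < c \<and> z $ j < c \<and> same_box m l u' x z) \<or>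
        (c \<le> x $ j \<and> c \<le> z $ j \<and> same_box m l' u x z)" for m
    proof -
      have "same_dyadic ((m(j := Suc (m j))) i) (l $ i) (u $ i) (x $ i) (z $ i) \<longleftrightarrow>
        (if i = j then (x $ j < c \<and> z $ j < c \<and> same_dyadic (m j) (l $ j) c (x $ j) (z $ j))
            \<or> (c \<le> x $ j \<and> c \<le> z $ j \<and> same_dyadic (m j) c (u $ j) (x $ j) (z $ j))
         else same_dyadic (m i) (l $ i) (u $ i) (x $ i) (z $ i))" for i
        by (simp add: Let_def c_def)
      moreover have "same_dyadic (m i) (l $ i) (u' $ i) (x $ i) (z $ i) \<longleftrightarrow>
        (if i = j then same_dyadic (m j) (l $ j) c (x $ j) (z $ j)
         else same_dyadic (m i) (l $ i) (u $ i) (x $ i) (z $ i))" for i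
        by (simp add: u'_def)
      moreover have "same_dyadic (m i) (l' $ i) (u $ i) (x $ i) (z $ i) \<longleftrightarrow>
        (if i = j then same_dyadic (m j) c (u $ j) (x $ j) (z $ j)
         else same_dyadic (m i) (l $ i) (u $ i) (x $ i) (z $ i))" for i
        by (simp add: l'_def)
      ultimately show ?thesis by (simp only: if_bool_eq_conj all_conj_distrib) blast
    qed
    \<comment> \<open>Both points go down, both go up, or the root split separates them; in the last
      case both sides of the equation vanish.\<close>
    consider "x $ j < c" "z $ j < c" | "c \<le> x $ j" "c \<le> z $ j"
      | "\<not> (x $ j < c \<and> z $ j < c)" "\<not> (c \<le> x $ j \<and> c \<le> z $ j)" by linarith
    then show ?thesis
    proof cases
      case 1
      have "z \<in> leaf_in (Split j s t) l u UNIV x \<longleftrightarrow> z \<in> leaf_in s l u' UNIV x"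
        "same_box (m(j := Suc (m j))) l u x z \<longleftrightarrow> same_box m l u' x z" for s t m
        using 1 unfolding leaf box by auto
      then show ?thesis using Suc[of l u']
        by (simp add: indicator_def of_bool_def del: leaf_in.simps same_dyadic.simps fun_upd_apply flip: nn_integral_indicator)
    next
      case 2
      have "z \<in> leaf_in (Split j s t) l u UNIV x \<longleftrightarrow> z \<in> leaf_in t l' u UNIV x"
        "same_box (m(j := Suc (m j))) l u x z \<longleftrightarrow> same_box m l' u x z" for s t m
        using 2 unfolding leaf box by auto
      then show ?thesis using Suc[of l' u]
        by (simp add: indicator_def of_bool_def del: leaf_in.simps same_dyadic.simps fun_upd_apply flip: nn_integral_indicator)
    next
      case 3
      have F: "z \<in> leaf_in (Split j s t) l u UNIV x \<longleftrightarrow> False"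
        "same_box (m(j := Suc (m j))) l u x z \<longleftrightarrow> False" for s t m
        using 3 unfolding leaf box by auto
      show ?thesis by (simp only: F indicator_def mem_Collect_eq of_bool_eq split_avg_const) simp
    qed
  qed
  have "emeasure (measure_pmf (centered_tree_pmf (Suc k))) {\<theta>. z \<in> leaf_in \<theta> l u UNIV x}
     = (\<Sum>j\<in>UNIV. ennreal (split_avg k (\<lambda>m. of_bool (same_box (m(j := Suc (m j))) l u x z)))) / CARD('d)"
    unfolding step[symmetric] by (simp add: nn_integral_pmf_of_set del: leaf_in.simps)
  also have "\<dots> = ennreal (split_avg (Suc k) (\<lambda>m. of_bool (same_box m l u x z)))"
    by (simp add: sum_ennreal split_avg_nonneg divide_ennreal sum_nonneg ennreal_of_nat_eq_real_of_nat
        del: fun_upd_apply same_dyadic.simps)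
  finally show ?case .
qed

lemma kerf_kernel_eq:
  "kerf_kernel k x z = of_bool (z \<in> cbox 0 1) * split_avg k (\<lambda>m. of_bool (same_box m 0 1 x z))"
proof -
  have "{\<theta>. z \<in> leaf_cell x \<theta>} = (if z \<in> cbox 0 1 then {\<theta>. z \<in> leaf_in \<theta> 0 1 UNIV x} else {})"
    using leaf_in_Int[of _ 0 1 "cbox 0 1" x] by (auto simp: leaf_cell_def)
  moreover have "measure_pmf.prob (centered_tree_pmf k) {\<theta>. z \<in> leaf_in \<theta> 0 1 UNIV x}
      = split_avg k (\<lambda>m. of_bool (same_box m 0 1 x z))"
    by (simp add: measure_def emeasure_leaf_in split_avg_nonneg)
  ultimately show ?thesis by (simp add: kerf_kernel_def)
qed

lemma kerf_kernel_nonneg: "0 \<le> kerf_kernel k x z"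
  by (simp add: kerf_kernel_def)

lemma kerf_kernel_le_1: "kerf_kernel k x z \<le> 1"
  by (simp add: kerf_kernel_def)

lemma vec_nth_measurable [measurable (raw)]:
  fixes f :: "'a \<Rightarrow> real^'d::finite"
  assumes "f \<in> borel_measurable N"
  shows "(\<lambda>w. f w $ i) \<in> borel_measurable N"
  using assms by (rule borel_measurable_continuous_on[rotated]) (intro continuous_intros)

lemma kerf_kernel_measurable [measurable]:
  assumes [measurable]: "f \<in> borel_measurable N" "g \<in> borel_measurable N"
  shows "(\<lambda>w. kerf_kernel k (f w) (g w)) \<in> borel_measurable N"
proof -
  have [measurable]: "(\<lambda>w. split_avg k (\<lambda>m. of_bool (same_box m 0 1 (f w) (g w)))) \<in> borel_measurable N"
    by measurable
  show ?thesis unfolding kerf_kernel_eq by measurable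
qed

lemma same_box_sets: "{z. same_box m l u x z} \<in> sets borel"
  by measurable

section \<open>The uniform law on the cube and the volumes of boxes\<close>

abbreviation unif :: "(real^'d::finite) measure" where
  "unif \<equiv> uniform_measure lborel (cbox 0 1)"

lemma emeasure_lborel_unit_cube: "emeasure lborel (cbox 0 1 :: (real^'d::finite) set) = 1"
  by (subst emeasure_lborel_cbox_eq) (auto simp: Basis_vec_def inner_axis intro!: prod.neutral)

lemma prob_space_unif: "prob_space (unif :: (real^'d::finite) measure)"
  by (intro prob_space_uniform_measure) (auto simp: emeasure_lborel_unit_cube)

lemma prod_Basis_vec: "(\<Prod>b\<in>Basis. (v :: real^'d::finite) \<bullet> b) = (\<Prod>i\<in>UNIV. v $ i)"
proof -
  have B: "(Basis :: (real^'d) set) = range (\<lambda>i. axis i 1)" by (auto simp: Basis_vec_def)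
  have I: "inj (\<lambda>i. axis i (1::real) :: real^'d)" by (auto simp: inj_on_def axis_eq_axis)
  show ?thesis unfolding B by (subst prod.reindex[OF I]) (simp add: inner_axis)
qed

text \<open>The cell lies between an open and a closed box with the same corners, and these have
  equal Lebesgue measure. The value does not depend on the position of \<open>x\<close>.\<close>

lemma measure_same_box:
  fixes x :: "real^'d::finite"
  assumes "x \<in> cbox 0 1"
  shows "measure unif {z. same_box m 0 1 x z} = (\<Prod>i\<in>UNIV. (1 / 2) ^ m i)"
proof -
  have "\<forall>i. \<exists>l h. h - l = (1 / 2) ^ m i \<and> 0 \<le> l \<and> h \<le> 1 \<and>
    {l<..<h} \<subseteq> {z. same_dyadic (m i) 0 1 (x $ i) z} \<and> {z\<in>{0..1}. same_dyadic (m i) 0 1 (x $ i) z} \<subseteq> {l..h}"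
    using assms same_dyadic_interval[of "x $ _" 0 1] by (simp add: mem_box_cart power_one_over)
  then obtain l h where LH: "\<forall>i. h i - l i = (1 / 2) ^ m i \<and> 0 \<le> l i \<and> h i \<le> 1 \<and>
    {l i<..<h i} \<subseteq> {z. same_dyadic (m i) 0 1 (x $ i) z} \<and> {z\<in>{0..1}. same_dyadic (m i) 0 1 (x $ i) z} \<subseteq> {l i..h i}"
    unfolding choice_iff by blast
  then have lh: "h i - l i = (1 / 2) ^ m i" "0 \<le> l i" "h i \<le> 1" for i
    by auto
  have sub1: "same_dyadic (m i) 0 1 (x $ i) t" if "l i < t" "t < h i" for i t
    using LH that by (auto simp: subset_iff)
  have sub2: "l i \<le> t" "t \<le> h i" if "same_dyadic (m i) 0 1 (x $ i) t" "0 \<le> t" "t \<le> 1" for i t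
    using LH that by (auto simp: subset_iff)
  let ?l = "\<chi> i. l i" and ?h = "\<chi> i. h i" and ?S = "cbox 0 1 \<inter> {z. same_box m 0 1 x z}"
  have le: "l i \<le> h i" for i
    using lh(1)[of i] zero_le_power[of "1/2::real" "m i"] by linarith
  have S1: "box ?l ?h \<subseteq> ?S"
  proof
    fix z assume "z \<in> box ?l ?h"
    then have z: "l i < z $ i" "z $ i < h i" for i by (auto simp: mem_box_cart)
    have "0 \<le> z $ i" "z $ i \<le> 1" for i
      using z[of i] lh(2,3)[of i] by linarith+
    then show "z \<in> ?S" using z sub1 by (auto simp: mem_box_cart)
  qed
  have S2: "?S \<subseteq> cbox ?l ?h"
    using sub2 by (auto simp: mem_box_cart)
  have S3: "?S \<in> sets lborel" by (simp add: same_box_sets)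
  have lB: "?l \<bullet> b \<le> ?h \<bullet> b" if "b \<in> Basis" for b
    using that le by (auto simp: Basis_vec_def inner_axis)
  have E1: "emeasure lborel (box ?l ?h) = ennreal (\<Prod>i\<in>UNIV. h i - l i)"
    by (subst emeasure_lborel_box) (simp_all add: prod_Basis_vec lB)
  have E2: "emeasure lborel (cbox ?l ?h) = ennreal (\<Prod>i\<in>UNIV. h i - l i)"
    by (subst emeasure_lborel_cbox) (simp_all add: prod_Basis_vec lB)
  have "emeasure lborel ?S = ennreal (\<Prod>i\<in>UNIV. h i - l i)"
  proof (rule antisym)
    show "emeasure lborel ?S \<le> ennreal (\<Prod>i\<in>UNIV. h i - l i)"
      unfolding E2[symmetric] by (rule emeasure_mono[OF S2]) simp
    show "ennreal (\<Prod>i\<in>UNIV. h i - l i) \<le> emeasure lborel ?S"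
      unfolding E1[symmetric] by (rule emeasure_mono[OF S1 S3])
  qed
  then have "emeasure unif {z. same_box m 0 1 x z} = ennreal (\<Prod>i\<in>UNIV. (1 / 2) ^ m i)"
    using lh(1) by (subst emeasure_uniform_measure) (auto simp: emeasure_lborel_unit_cube same_box_sets divide_ennreal_def)
  then show ?thesis by (simp add: measure_def prod_nonneg)
qed

section \<open>Moments of the kernel\<close>

lemma integral_same_box:
  fixes x :: "real^'d::finite"
  assumes "x \<in> cbox 0 1"
  shows "integrable unif (\<lambda>z. of_bool (same_box m 0 1 x z) :: real)"
    and "(\<integral>z. of_bool (same_box m 0 1 x z) \<partial>unif) = (\<Prod>i\<in>UNIV. (1 / 2 :: real) ^ m i)"
proof -
  interpret U: prob_space "unif :: (real^'d) measure" by (rule prob_space_unif)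
  have eq: "(\<lambda>z. of_bool (same_box m 0 1 x z) :: real) = indicator {z. same_box m 0 1 x z}"
    by (auto simp: fun_eq_iff)
  have S: "{z. same_box m 0 1 x z} \<in> sets (unif :: (real^'d) measure)"
    by (simp add: same_box_sets)
  show "integrable unif (\<lambda>z. of_bool (same_box m 0 1 x z) :: real)"
    unfolding eq by (intro integrable_real_indicator S) (simp add: U.emeasure_eq_measure)
  show "(\<integral>z. of_bool (same_box m 0 1 x z) \<partial>unif) = (\<Prod>i\<in>UNIV. (1 / 2 :: real) ^ m i)"
    unfolding eq using S measure_same_box[OF assms, of m] by simp
qed

lemma AE_unif_cbox: "AE z in unif. z \<in> cbox 0 (1 :: real^'d::finite)"
  by (subst AE_uniform_measure) (auto simp: emeasure_lborel_unit_cube)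

lemma kerf_kernel_integrable:
  "integrable unif (kerf_kernel k (x :: real^'d::finite))"
    "integrable unif (\<lambda>z. (kerf_kernel k (x :: real^'d::finite) z)\<^sup>2)"
proof -
  interpret U: prob_space "unif :: (real^'d) measure" by (rule prob_space_unif)
  have [measurable]: "kerf_kernel k x \<in> borel_measurable unif"
    by (simp add: kerf_kernel_measurable)
  show "integrable unif (kerf_kernel k x)"
    by (rule U.integrable_const_bound[of _ 1]) (auto simp: kerf_kernel_nonneg kerf_kernel_le_1)
  show "integrable unif (\<lambda>z. (kerf_kernel k x z)\<^sup>2)"
    by (rule U.integrable_const_bound[of _ 1]) (auto simp: kerf_kernel_nonneg kerf_kernel_le_1 power_le_one)
qed

lemma integral_kerf_kernel:
  fixes x :: "real^'d::finite"
  assumes "x \<in> cbox 0 1"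
  shows "(\<integral>z. kerf_kernel k x z \<partial>unif) = (1 / 2) ^ k"
proof -
  have "(\<integral>z. kerf_kernel k x z \<partial>unif) = (\<integral>z. split_avg k (\<lambda>m. of_bool (same_box m 0 1 x z)) \<partial>unif)"
    using AE_unif_cbox
    by (intro integral_cong_AE) (auto simp: kerf_kernel_eq elim: eventually_mono)
  also have "\<dots> = split_avg k (\<lambda>m :: 'd \<Rightarrow> nat. \<Prod>i\<in>UNIV. (1 / 2) ^ m i)"
    by (subst split_avg_integral(2), intro integral_same_box(1)[OF assms],
        simp only: integral_same_box(2)[OF assms])
  also have "\<dots> = split_avg k (\<lambda>m :: 'd \<Rightarrow> nat. (1 / 2) ^ k)"
    by (intro split_avg_cong) (simp flip: power_sum)
  finally show ?thesis by simp
qed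

section \<open>The second moment of the kernel\<close>

lemma sum_power_le_geometric:
  fixes r :: real
  assumes "0 \<le> r" "r < 1" "finite A" "inj_on f A"
  shows "(\<Sum>a\<in>A. r ^ f a) \<le> 1 / (1 - r)"
proof -
  have "(\<Sum>a\<in>A. r ^ f a) = (\<Sum>n\<in>f ` A. r ^ n)"
    by (simp add: sum.reindex[OF assms(4)])
  also have "\<dots> \<le> (\<Sum>n. r ^ n)"
    using assms by (intro sum_le_suminf) (auto simp: summable_geometric)
  also have "\<dots> = 1 / (1 - r)" using assms by (simp add: suminf_geometric)
  finally show ?thesis .
qed

text \<open>With truncated subtraction, \<open>(b - a) + (a - b)\<close> is the distance of
  \<open>a\<close> and \<open>b\<close>. On each side of \<open>b\<close> the distances are
  distinct, so each side is dominated by a geometric series.\<close>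

lemma sum_power_dist_le:
  fixes r :: real and b k :: nat
  assumes "0 \<le> r" "r < 1"
  shows "(\<Sum>a\<le>k. r ^ ((b - a) + (a - b))) \<le> 2 / (1 - r)"
proof -
  have "(\<Sum>a\<le>k. r ^ ((b - a) + (a - b)))
      = (\<Sum>a\<in>{..k} \<inter> {..b}. r ^ ((b - a) + (a - b))) + (\<Sum>a\<in>{..k} - {..b}. r ^ ((b - a) + (a - b)))"
    by (rule sum.Int_Diff) simp
  also have "\<dots> \<le> 1 / (1 - r) + 1 / (1 - r)"
    by (rule add_mono; rule sum_power_le_geometric[OF assms]) (auto simp: inj_on_def)
  finally show ?thesis by simp
qed

text \<open>One two-sided geometric series of ratio \<open>sqrt (1 / 2)\<close> per coordinate,
  bounded by twice the one-sided series.\<close>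

definition kernel_const :: "nat \<Rightarrow> real" where
  "kernel_const d = (2 / (1 - sqrt (1 / 2))) ^ d"

text \<open>An upper bound for E K^2 / E K at depth \<open>k\<close>: the bound on the largest
  multinomial probability times the geometric sums over the second count vector.\<close>

definition kernel_decay :: "nat \<Rightarrow> nat \<Rightarrow> real" where
  "kernel_decay d k = kernel_const d * real (Suc (k div d)) powr (- ((real d - 1) / 2))"

text \<open>Each multinomial probability is replaced by the largest one; what is left is a sum of
  geometric weights around \<open>m\<close>, bounded uniformly in \<open>m\<close>.\<close>

lemma split_avg_dist_le:
  fixes m :: "'d::finite \<Rightarrow> nat"
  shows "split_avg k (\<lambda>m'. \<Prod>i\<in>UNIV. sqrt (1 / 2) ^ ((m i - m' i) + (m' i - m i)))
    \<le> kernel_decay CARD('d) k"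
proof -
  define r where "r = sqrt (1 / 2)"
  define h where "h v = (\<Prod>i\<in>UNIV. r ^ ((m i - v i) + (v i - m i)))" for v
  \<comment> \<open>A finite set containing all vectors of sum \<open>k\<close>. Giving up the
    constraint on the sum makes it a product set, over which the sum of \<open>h\<close> factors
    into one-dimensional sums.\<close>
  define V where "V = (UNIV :: 'd set) \<rightarrow>\<^sub>E {..k}"
  define p where "p = real (Suc (k div CARD('d))) powr (- ((real CARD('d) - 1) / 2))"
  have r: "0 \<le> r" "r < 1" by (auto simp: r_def)
  have h0: "0 \<le> h v" for v using r by (simp add: h_def prod_nonneg)
  have "finite V" by (auto simp: V_def intro!: finite_PiE)
  have "split_avg k h = split_avg k (\<lambda>m'. \<Sum>v\<in>V. h v * of_bool (m' = v))"
  proof (rule split_avg_cong)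
    fix m' :: "'d \<Rightarrow> nat" assume "sum m' UNIV = k"
    then have "m' i \<le> k" for i using member_le_sum[of i UNIV m'] by auto
    then have "m' \<in> V" by (auto simp: V_def)
    then show "h m' = (\<Sum>v\<in>V. h v * of_bool (m' = v))"
      using \<open>finite V\<close> by (simp add: of_bool_def if_distrib[of "(*) _"] cong: if_cong)
  qed
  also have "\<dots> = (\<Sum>v\<in>V. h v * split_avg k (\<lambda>m'. of_bool (m' = v)))"
    by (simp only: split_avg_sum split_avg_cmult)
  also have "\<dots> \<le> (\<Sum>v\<in>V. h v * p)"
    unfolding p_def by (intro sum_mono mult_left_mono split_avg_point_le h0)
  also have "\<dots> = p * (\<Sum>v\<in>V. h v)" by (simp add: sum_distrib_left mult.commute)
  also have "(\<Sum>v\<in>V. h v) = (\<Prod>i\<in>UNIV. \<Sum>a\<le>k. r ^ ((m i - a) + (a - m i)))"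
    unfolding h_def V_def by (rule prod_sum_PiE[symmetric]) auto
  also have "\<dots> \<le> (\<Prod>i\<in>(UNIV::'d set). 2 / (1 - r))"
    using r by (intro prod_mono conjI sum_nonneg sum_power_dist_le) auto
  also have "\<dots> = kernel_const CARD('d)" by (simp add: kernel_const_def r_def)
  finally have "split_avg k h \<le> p * kernel_const CARD('d)"
    by (simp add: p_def mult_left_mono)
  then show ?thesis by (simp add: h_def[abs_def] r_def p_def kernel_decay_def mult.commute)
qed

text \<open>This is 2 max(a, b) = a + b + |a - b|. Square roots separate the contributions of
  \<open>a\<close> and \<open>b\<close> from that of their distance.\<close>

lemma half_power_max:
  "(1 / 2 :: real) ^ max a b = sqrt (1 / 2) ^ a * sqrt (1 / 2) ^ b * sqrt (1 / 2) ^ ((a - b) + (b - a))"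
proof -
  have "(1 / 2 :: real) ^ max a b = (sqrt (1 / 2) ^ 2) ^ max a b" by simp
  also have "\<dots> = sqrt (1 / 2) ^ (2 * max a b)" by (rule power_mult[symmetric])
  also have "2 * max a b = a + b + ((a - b) + (b - a))" by simp
  finally show ?thesis by (simp only: power_add)
qed

lemma integral_kerf_kernel_square_le:
  fixes x :: "real^'d::finite"
  assumes "x \<in> cbox 0 1"
  shows "(\<integral>z. (kerf_kernel k x z)\<^sup>2 \<partial>unif) \<le> (1 / 2) ^ k * kernel_decay CARD('d) k"
proof -
  have "(\<integral>z. (kerf_kernel k x z)\<^sup>2 \<partial>unif) = (\<integral>z. split_avg k (\<lambda>m. split_avg k (\<lambda>m'.
      of_bool (same_box (\<lambda>i. max (m i) (m' i)) 0 1 x z))) \<partial>unif)"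
  proof (intro integral_cong_AE)
    have "(kerf_kernel k x z)\<^sup>2 = split_avg k (\<lambda>m. split_avg k (\<lambda>m'.
      of_bool (same_box (\<lambda>i. max (m i) (m' i)) 0 1 x z)))" if "z \<in> cbox 0 1" for z
    proof -
      have "(kerf_kernel k x z)\<^sup>2 = split_avg k (\<lambda>m. of_bool (same_box m 0 1 x z) *
         split_avg k (\<lambda>m'. of_bool (same_box m' 0 1 x z)))"
        using that
        by (simp add: kerf_kernel_eq power2_eq_square mult.commute[of "of_bool _" "split_avg _ _"] split_avg_cmult)
      also have "\<dots> = split_avg k (\<lambda>m. split_avg k (\<lambda>m'. of_bool (same_box (\<lambda>i. max (m i) (m' i)) 0 1 x z)))"
        by (simp only: split_avg_cmult[symmetric] of_bool_conj[symmetric] same_dyadic_max all_conj_distrib)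
      finally show ?thesis .
    qed
    then show "AE z in unif. (kerf_kernel k x z)\<^sup>2 = split_avg k (\<lambda>m. split_avg k (\<lambda>m'.
      of_bool (same_box (\<lambda>i. max (m i) (m' i)) 0 1 x z)))"
      using AE_unif_cbox by (auto elim: eventually_mono)
  qed measurable
  also have "\<dots> = split_avg k (\<lambda>m :: 'd \<Rightarrow> nat. split_avg k (\<lambda>m' :: 'd \<Rightarrow> nat. \<Prod>i\<in>UNIV. (1 / 2) ^ max (m i) (m' i)))"
    by (subst split_avg_integral(2), intro split_avg_integral(1) integral_same_box(1)[OF assms],
        subst split_avg_integral(2), intro integral_same_box(1)[OF assms],
        simp only: integral_same_box(2)[OF assms])
  \<comment> \<open>Both count vectors sum to \<open>k\<close>, so their separate factors multiply
    to the constant 2^-k and only the distance factor is left to average.\<close>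
  also have "\<dots> = split_avg k (\<lambda>m :: 'd \<Rightarrow> nat. split_avg k (\<lambda>m' :: 'd \<Rightarrow> nat. (1 / 2) ^ k *
      (\<Prod>i\<in>UNIV. sqrt (1 / 2) ^ ((m i - m' i) + (m' i - m i)))))"
  proof (intro split_avg_cong)
    fix m m' :: "'d \<Rightarrow> nat" assume "sum m UNIV = k" "sum m' UNIV = k"
    then have "(\<Prod>i\<in>UNIV. sqrt (1 / 2) ^ m i) * (\<Prod>i\<in>UNIV. sqrt (1 / 2) ^ m' i) = (1 / 2 :: real) ^ k"
      by (simp flip: power_sum power_mult_distrib)
    then show "(\<Prod>i\<in>UNIV. (1 / 2 :: real) ^ max (m i) (m' i)) =
      (1 / 2) ^ k * (\<Prod>i\<in>UNIV. sqrt (1 / 2) ^ ((m i - m' i) + (m' i - m i)))"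
      by (simp only: half_power_max prod.distrib)
  qed
  also have "\<dots> = (1 / 2) ^ k * split_avg k (\<lambda>m :: 'd \<Rightarrow> nat. split_avg k (\<lambda>m' :: 'd \<Rightarrow> nat.
      (\<Prod>i\<in>UNIV. sqrt (1 / 2) ^ ((m i - m' i) + (m' i - m i)))))"
    by (simp only: split_avg_cmult)
  also have "\<dots> \<le> (1 / 2) ^ k * split_avg k (\<lambda>m :: 'd \<Rightarrow> nat. kernel_decay CARD('d) k)"
    by (intro mult_left_mono split_avg_mono split_avg_dist_le) auto
  finally show ?thesis by simp
qed

lemma kerf_kernel_dist_integrable:
  fixes x :: "real^'d::finite"
  shows "integrable unif (\<lambda>z. kerf_kernel k x z * (norm (x - z))\<^sup>2)"
proof -
  interpret U: prob_space "unif :: (real^'d) measure" by (rule prob_space_unif)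
  have "bounded (cbox 0 1 :: (real^'d) set)" by (rule bounded_cbox)
  then obtain b where b: "norm z \<le> b" if "z \<in> cbox 0 1" for z :: "real^'d"
    by (auto simp: bounded_iff)
  show ?thesis
  proof (rule U.integrable_const_bound)
    show "AE z in unif. norm (kerf_kernel k x z * (norm (x - z))\<^sup>2) \<le> 1 * (norm x + b)\<^sup>2"
      using AE_unif_cbox
    proof eventually_elim
      case (elim z)
      have "norm (x - z) \<le> norm x + b" using norm_triangle_ineq4[of x z] b[OF elim] by linarith
      then have "kerf_kernel k x z * (norm (x - z))\<^sup>2 \<le> 1 * (norm x + b)\<^sup>2"
        by (intro mult_mono power_mono) (auto simp: kerf_kernel_le_1 kerf_kernel_nonneg)
      then show ?case by (simp add: kerf_kernel_nonneg)
    qed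
  qed (auto intro!: borel_measurable_times kerf_kernel_measurable)
qed

text \<open>A box with counts \<open>m\<close> has sides 2^-(m i), so squared distances within it
  are at most the sum of the 4^-(m i), while its volume is 2^-k for every \<open>m\<close>. The
  average of 4^-(m i) is the generating function at 1/4, which yields the base 1 - 3/(4d).\<close>

lemma integral_kerf_kernel_dist_le:
  fixes x :: "real^'d::finite"
  assumes "x \<in> cbox 0 1"
  shows "(\<integral>z. kerf_kernel k x z * (norm (x - z))\<^sup>2 \<partial>unif)
    \<le> (1 / 2) ^ k * (CARD('d) * (1 - 3 / (4 * real CARD('d))) ^ k)"
proof -
  have "(\<integral>z. kerf_kernel k x z * (norm (x - z))\<^sup>2 \<partial>unif)
    \<le> (\<integral>z. split_avg k (\<lambda>m. (\<Sum>i\<in>UNIV. (1 / 4) ^ m i) * of_bool (same_box m 0 1 x z)) \<partial>unif)"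
  proof (rule integral_mono_AE)
    show "integrable unif (\<lambda>z. split_avg k (\<lambda>m. (\<Sum>i\<in>UNIV. (1 / 4) ^ m i) * of_bool (same_box m 0 1 x z)))"
      by (intro split_avg_integral integrable_mult_right integral_same_box assms)
    show "AE z in unif. kerf_kernel k x z * (norm (x - z))\<^sup>2
      \<le> split_avg k (\<lambda>m. (\<Sum>i\<in>UNIV. (1 / 4) ^ m i) * of_bool (same_box m 0 1 x z))"
      using AE_unif_cbox
    proof eventually_elim
      case (elim z)
      have *: "(norm (x - z))\<^sup>2 \<le> (\<Sum>i\<in>UNIV. (1 / 4) ^ m i)" if "same_box m 0 1 x z" for m
      proof -
        have "(norm (x - z))\<^sup>2 = (\<Sum>i\<in>UNIV. (x $ i - z $ i)\<^sup>2)"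
          unfolding power2_norm_eq_inner inner_vec_def by (simp add: power2_eq_square)
        also have "\<dots> \<le> (\<Sum>i\<in>UNIV. (1 / 4) ^ m i)"
        proof (rule sum_mono)
          fix i
          have "\<bar>x $ i - z $ i\<bar> \<le> (1 - 0) / 2 ^ m i"
            using that assms elim by (intro same_dyadic_diff_le) (auto simp: mem_box_cart)
          then have "\<bar>x $ i - z $ i\<bar>\<^sup>2 \<le> ((1 / 2) ^ m i)\<^sup>2"
            by (intro power_mono) (auto simp: power_one_over)
          also have "((1 / 2 :: real) ^ m i)\<^sup>2 = ((1 / 2)\<^sup>2) ^ m i" by (simp only: power_mult[symmetric] mult.commute)
          finally show "(x $ i - z $ i)\<^sup>2 \<le> (1 / 4) ^ m i" by (simp add: power2_eq_square)
        qed
        finally show ?thesis .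
      qed
      have "kerf_kernel k x z * (norm (x - z))\<^sup>2
          = split_avg k (\<lambda>m. (norm (x - z))\<^sup>2 * of_bool (same_box m 0 1 x z))"
        using elim by (simp add: kerf_kernel_eq split_avg_cmult)
      also have "\<dots> \<le> split_avg k (\<lambda>m. (\<Sum>i\<in>UNIV. (1 / 4) ^ m i) * of_bool (same_box m 0 1 x z))"
        using * by (intro split_avg_mono) auto
      finally show ?case .
    qed
  qed (rule kerf_kernel_dist_integrable)
  also have "\<dots> = split_avg k (\<lambda>m :: 'd \<Rightarrow> nat. (\<Sum>i\<in>UNIV. (1 / 4) ^ m i) * (\<Prod>i\<in>UNIV. (1 / 2) ^ m i))"
    by (subst split_avg_integral(2), intro integrable_mult_right integral_same_box(1)[OF assms],
        simp only: integral_mult_right_zero integral_same_box(2)[OF assms])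
  also have "\<dots> = split_avg k (\<lambda>m :: 'd \<Rightarrow> nat. (1 / 2) ^ k * (\<Sum>i\<in>UNIV. (1 / 4) ^ m i))"
    by (intro split_avg_cong) (simp flip: power_sum)
  also have "\<dots> = (1 / 2) ^ k * (CARD('d) * (1 - 3 / (4 * real CARD('d))) ^ k)"
    by (simp add: split_avg_cmult split_avg_sum split_avg_power)
  finally show ?thesis .
qed

section \<open>Independence and centered sums\<close>

lemma (in prob_space) distr_independent_rvs:
  assumes "independent_rvs M N1 A N2 B"
  shows "distr M (N1 \<Otimes>\<^sub>M N2) (\<lambda>\<omega>. (A \<omega>, B \<omega>)) = distr M N1 A \<Otimes>\<^sub>M distr M N2 B"
proof -
  have [measurable]: "A \<in> measurable M N1" "B \<in> measurable M N2"
    and ind: "indep_set {A -` S \<inter> space M | S. S \<in> sets N1} {B -` S \<inter> space M | S. S \<in> sets N2}"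
    using assms by (auto simp: independent_rvs_def)
  interpret A: prob_space "distr M N1 A" by (rule prob_space_distr) simp
  interpret B: prob_space "distr M N2 B" by (rule prob_space_distr) simp
  show ?thesis
  proof (rule pair_measure_eqI[symmetric])
    fix S T assume "S \<in> sets (distr M N1 A)" "T \<in> sets (distr M N2 B)"
    then have [measurable]: "S \<in> sets N1" "T \<in> sets N2" by auto
    have "emeasure (distr M (N1 \<Otimes>\<^sub>M N2) (\<lambda>\<omega>. (A \<omega>, B \<omega>))) (S \<times> T)
        = prob ((A -` S \<inter> space M) \<inter> (B -` T \<inter> space M))"
      by (subst emeasure_distr) (auto simp: emeasure_eq_measure intro!: arg_cong[of _ _ prob])
    also have "\<dots> = prob (A -` S \<inter> space M) * prob (B -` T \<inter> space M)"
      by (subst indep_setD[OF ind]) auto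
    finally show "emeasure (distr M N1 A) S * emeasure (distr M N2 B) T
        = emeasure (distr M (N1 \<Otimes>\<^sub>M N2) (\<lambda>\<omega>. (A \<omega>, B \<omega>))) (S \<times> T)"
      by (simp add: emeasure_distr emeasure_eq_measure ennreal_mult)
  qed (simp_all add: A.sigma_finite_measure_axioms B.sigma_finite_measure_axioms cong: sets_pair_measure_cong)
qed

text \<open>Fubini for independent variables. The nonnegative integral is used so that integrability
  can be a consequence of the bounds.\<close>

lemma (in prob_space) nn_integral_independent_rvs:
  assumes ind: "independent_rvs M N1 A N2 B"
    and h [measurable]: "case_prod h \<in> borel_measurable (N1 \<Otimes>\<^sub>M N2)"
  shows "(\<integral>\<^sup>+\<omega>. h (A \<omega>) (B \<omega>) \<partial>M) = (\<integral>\<^sup>+\<omega>. \<integral>\<^sup>+\<omega>'. h (A \<omega>) (B \<omega>') \<partial>M \<partial>M)"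
proof -
  have [measurable]: "A \<in> measurable M N1" "B \<in> measurable M N2"
    using ind by (auto simp: independent_rvs_def)
  interpret B: prob_space "distr M N2 B" by (rule prob_space_distr) simp
  have h': "case_prod h \<in> borel_measurable (distr M N1 A \<Otimes>\<^sub>M distr M N2 B)"
    using h by (simp cong: measurable_cong_sets sets_pair_measure_cong)
  have "(\<integral>\<^sup>+\<omega>. h (A \<omega>) (B \<omega>) \<partial>M)
      = (\<integral>\<^sup>+p. case_prod h p \<partial>distr M (N1 \<Otimes>\<^sub>M N2) (\<lambda>\<omega>. (A \<omega>, B \<omega>)))"
    by (subst nn_integral_distr) auto
  also have "\<dots> = (\<integral>\<^sup>+x. \<integral>\<^sup>+y. h x y \<partial>distr M N2 B \<partial>distr M N1 A)"
    unfolding distr_independent_rvs[OF ind] using B.nn_integral_fst[OF h'] by simp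
  also have "\<dots> = (\<integral>\<^sup>+x. \<integral>\<^sup>+\<omega>'. h x (B \<omega>') \<partial>M \<partial>distr M N1 A)"
    by (intro nn_integral_cong nn_integral_distr) (auto simp: measurable_Pair2[OF h])
  also have "\<dots> = (\<integral>\<^sup>+\<omega>. \<integral>\<^sup>+\<omega>'. h (A \<omega>) (B \<omega>') \<partial>M \<partial>M)"
    by (subst nn_integral_distr) auto
  finally show ?thesis .
qed

lemma (in prob_space) expectation_square_sum_centered:
  fixes W :: "'i \<Rightarrow> 'a \<Rightarrow> real"
  assumes "finite I" and ind: "indep_vars (\<lambda>_. borel) W I"
    and sq: "\<And>i. i \<in> I \<Longrightarrow> integrable M (\<lambda>\<omega>. (W i \<omega>)\<^sup>2)"
    and cent: "\<And>i. i \<in> I \<Longrightarrow> expectation (W i) = 0"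
  shows "integrable M (\<lambda>\<omega>. (\<Sum>i\<in>I. W i \<omega>)\<^sup>2)"
    and "expectation (\<lambda>\<omega>. (\<Sum>i\<in>I. W i \<omega>)\<^sup>2) = (\<Sum>i\<in>I. expectation (\<lambda>\<omega>. (W i \<omega>)\<^sup>2))"
proof -
  have rv: "W i \<in> borel_measurable M" if "i \<in> I" for i
    using ind that by (auto simp: indep_vars_def)
  have int: "integrable M (W i)" if "i \<in> I" for i
    using square_integrable_imp_integrable[OF rv[OF that] sq[OF that]] .
  have cross: "integrable M (\<lambda>\<omega>. W i \<omega> * W j \<omega>) \<and>
      expectation (\<lambda>\<omega>. W i \<omega> * W j \<omega>) = (if i = j then expectation (\<lambda>\<omega>. (W i \<omega>)\<^sup>2) else 0)"
    if "i \<in> I" "j \<in> I" for i j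
  proof (cases "i = j")
    case True
    then show ?thesis using sq[OF \<open>i \<in> I\<close>] by (simp add: power2_eq_square)
  next
    case False
    have ind2: "indep_vars (\<lambda>_. borel) W {i, j}"
      by (rule indep_vars_subset[OF ind]) (use that in auto)
    have "integrable M (\<lambda>\<omega>. \<Prod>l\<in>{i, j}. W l \<omega>)"
      by (rule indep_vars_integrable[OF _ ind2]) (use that int in auto)
    moreover have "expectation (\<lambda>\<omega>. \<Prod>l\<in>{i, j}. W l \<omega>) = (\<Prod>l\<in>{i, j}. expectation (W l))"
      by (rule indep_vars_lebesgue_integral[OF _ ind2]) (use that int in auto)
    ultimately show ?thesis using False cent[OF that(1)] by simp
  qed
  have eq: "(\<Sum>i\<in>I. W i \<omega>)\<^sup>2 = (\<Sum>i\<in>I. \<Sum>j\<in>I. W i \<omega> * W j \<omega>)" for \<omega>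
    by (simp add: power2_eq_square sum_product)
  show "integrable M (\<lambda>\<omega>. (\<Sum>i\<in>I. W i \<omega>)\<^sup>2)"
    unfolding eq using cross by (intro Bochner_Integration.integrable_sum) auto
  have "expectation (\<lambda>\<omega>. (\<Sum>i\<in>I. W i \<omega>)\<^sup>2) = (\<Sum>i\<in>I. \<Sum>j\<in>I. expectation (\<lambda>\<omega>. W i \<omega> * W j \<omega>))"
    unfolding eq using cross
    by (subst Bochner_Integration.integral_sum, intro Bochner_Integration.integrable_sum, blast,
        intro sum.cong refl Bochner_Integration.integral_sum, blast)
  also have "\<dots> = (\<Sum>i\<in>I. \<Sum>j\<in>I. if i = j then expectation (\<lambda>\<omega>. (W i \<omega>)\<^sup>2) else 0)"
    using cross by (intro sum.cong refl) auto
  also have "\<dots> = (\<Sum>i\<in>I. expectation (\<lambda>\<omega>. (W i \<omega>)\<^sup>2))"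
    using \<open>finite I\<close> by (intro sum.cong refl) simp
  finally show "expectation (\<lambda>\<omega>. (\<Sum>i\<in>I. W i \<omega>)\<^sup>2) = (\<Sum>i\<in>I. expectation (\<lambda>\<omega>. (W i \<omega>)\<^sup>2))" .
qed

text \<open>A conditional variance bound: with \<open>T\<close> frozen, the summands are independent
  and centered. It serves once with \<open>T\<close> the test point and \<open>V\<close> the
  training points, and once with \<open>T\<close> all points and \<open>V\<close> the noise.\<close>

lemma (in prob_space) nn_integral_square_sum_centered_le:
  fixes g :: "'i \<Rightarrow> 't \<Rightarrow> 'v \<Rightarrow> real"
  assumes "finite I"
    and ind: "independent_rvs M N T (PiM I (\<lambda>_. S)) (\<lambda>\<omega>. \<lambda>i\<in>I. V i \<omega>)"
    and iv: "indep_vars (\<lambda>_. S) V I"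
    and g: "\<And>i. i \<in> I \<Longrightarrow> case_prod (g i) \<in> borel_measurable (N \<Otimes>\<^sub>M S)"
    and sq: "\<And>i \<omega>. i \<in> I \<Longrightarrow> \<omega> \<in> space M \<Longrightarrow> integrable M (\<lambda>\<omega>'. (g i (T \<omega>) (V i \<omega>'))\<^sup>2)"
    and cent: "\<And>i \<omega>. i \<in> I \<Longrightarrow> \<omega> \<in> space M \<Longrightarrow> expectation (\<lambda>\<omega>'. g i (T \<omega>) (V i \<omega>')) = 0"
    and bound: "\<And>\<omega>. \<omega> \<in> space M \<Longrightarrow> (\<Sum>i\<in>I. expectation (\<lambda>\<omega>'. (g i (T \<omega>) (V i \<omega>'))\<^sup>2)) \<le> b \<omega>"
  shows "(\<integral>\<^sup>+\<omega>. ennreal ((\<Sum>i\<in>I. g i (T \<omega>) (V i \<omega>))\<^sup>2) \<partial>M) \<le> (\<integral>\<^sup>+\<omega>. ennreal (b \<omega>) \<partial>M)"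
proof -
  have T: "T \<in> measurable M N" using ind by (simp add: independent_rvs_def)
  have gm: "(\<lambda>p. g i (fst p) (snd p i)) \<in> borel_measurable (N \<Otimes>\<^sub>M PiM I (\<lambda>_. S))" if "i \<in> I" for i
    using measurable_compose[OF measurable_Pair[OF measurable_fst measurable_compose[OF measurable_snd measurable_component_singleton[OF that]]] g[OF that]] by simp
  have "(\<integral>\<^sup>+\<omega>. ennreal ((\<Sum>i\<in>I. g i (T \<omega>) (V i \<omega>))\<^sup>2) \<partial>M)
     = (\<integral>\<^sup>+\<omega>. ennreal ((\<Sum>i\<in>I. g i (T \<omega>) ((\<lambda>i\<in>I. V i \<omega>) i))\<^sup>2) \<partial>M)"
    by simp
  also have "\<dots> = (\<integral>\<^sup>+\<omega>. \<integral>\<^sup>+\<omega>'. ennreal ((\<Sum>i\<in>I. g i (T \<omega>) ((\<lambda>i\<in>I. V i \<omega>') i))\<^sup>2) \<partial>M \<partial>M)"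
    using gm by (intro nn_integral_independent_rvs[OF ind, of "\<lambda>t v. ennreal ((\<Sum>i\<in>I. g i t (v i))\<^sup>2)"])
      (simp add: case_prod_beta')
  also have "\<dots> \<le> (\<integral>\<^sup>+\<omega>. ennreal (b \<omega>) \<partial>M)"
  proof (rule nn_integral_mono)
    fix \<omega> assume \<omega>: "\<omega> \<in> space M"
    then have "T \<omega> \<in> space N" using T by (auto simp: measurable_space)
    then have "(\<lambda>v. g i (T \<omega>) v) \<in> borel_measurable S" if "i \<in> I" for i
      using measurable_Pair2[OF g[OF that]] by simp
    then have iv': "indep_vars (\<lambda>_. borel) (\<lambda>i \<omega>'. g i (T \<omega>) (V i \<omega>')) I"
      by (rule indep_vars_compose2[OF iv])
    note E = expectation_square_sum_centered[OF \<open>finite I\<close> iv' sq[OF _ \<omega>] cent[OF _ \<omega>]]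
    have "(\<integral>\<^sup>+\<omega>'. ennreal ((\<Sum>i\<in>I. g i (T \<omega>) (V i \<omega>'))\<^sup>2) \<partial>M)
        = ennreal (\<Sum>i\<in>I. expectation (\<lambda>\<omega>'. (g i (T \<omega>) (V i \<omega>'))\<^sup>2))"
      using E by (subst nn_integral_eq_integral) auto
    also have "\<dots> \<le> ennreal (b \<omega>)" by (rule ennreal_leI[OF bound[OF \<omega>]])
    finally show "(\<integral>\<^sup>+\<omega>'. ennreal ((\<Sum>i\<in>I. g i (T \<omega>) ((\<lambda>i\<in>I. V i \<omega>') i))\<^sup>2) \<partial>M) \<le> ennreal (b \<omega>)"
      by simp
  qed
  finally show ?thesis .
qed

text \<open>Disjoint groups of an independent family generate independent sigma-algebras. Choosing
  the groups gives each separation of test point, training points and noise needed below.\<close>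

lemma (in prob_space) independent_rvs_collect:
  assumes ind: "indep_sets F K" and I: "I \<subseteq> K" "J \<subseteq> K" "I \<inter> J = {}"
    and stable: "\<And>i. i \<in> K \<Longrightarrow> Int_stable (F i)"
    and A: "A \<in> measurable (sigma (space M) (\<Union>i\<in>I. F i)) N1"
    and B: "B \<in> measurable (sigma (space M) (\<Union>i\<in>J. F i)) N2"
  shows "independent_rvs M N1 A N2 B"
proof -
  have F: "F i \<subseteq> events" if "i \<in> K" for i using ind that by (auto simp: indep_sets_def)
  have pow: "(\<Union>i\<in>L. F i) \<subseteq> Pow (space M)" if "L \<subseteq> K" for L
    using F that sets.space_closed[of M] by (intro UN_least) blast
  have sub: "sigma_sets (space M) (\<Union>i\<in>L. F i) \<subseteq> events" if "L \<subseteq> K" for L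
    using F that by (intro sets.sigma_sets_subset) auto
  have "indep_sets (\<lambda>b. sigma_sets (space M) (\<Union>i\<in>case_bool I J b. F i)) UNIV"
  proof (rule indep_sets_collect_sigma)
    show "indep_sets F (\<Union>b\<in>UNIV. case_bool I J b)"
      by (rule indep_sets_mono_index[OF _ ind]) (use I in \<open>auto split: bool.splits\<close>)
    show "disjoint_family (case_bool I J)"
      using I by (auto simp: disjoint_family_on_def split: bool.splits)
  qed (use stable I in \<open>auto split: bool.splits\<close>)
  then have "indep_set (sigma_sets (space M) (\<Union>i\<in>I. F i)) (sigma_sets (space M) (\<Union>i\<in>J. F i))"
    unfolding indep_set_def by (rule indep_sets_cong[THEN iffD1, rotated 2]) (auto split: bool.splits)
  moreover have A': "A -` S \<inter> space M \<in> sigma_sets (space M) (\<Union>i\<in>I. F i)" if "S \<in> sets N1" for S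
    using measurable_sets[OF A that] pow[OF I(1)] by simp
  moreover have B': "B -` S \<inter> space M \<in> sigma_sets (space M) (\<Union>i\<in>J. F i)" if "S \<in> sets N2" for S
    using measurable_sets[OF B that] pow[OF I(2)] by simp
  ultimately have "indep_set {A -` S \<inter> space M | S. S \<in> sets N1} {B -` S \<inter> space M | S. S \<in> sets N2}"
    unfolding indep_sets2_eq by blast
  moreover have "A \<in> measurable M N1"
  proof (rule measurableI)
    show "A \<omega> \<in> space N1" if "\<omega> \<in> space M" for \<omega>
      using measurable_space[OF A] that by (simp add: space_measure_of_conv)
    show "A -` S \<inter> space M \<in> events" if "S \<in> sets N1" for S
      using A'[OF that] sub[OF I(1)] by blast
  qed
  moreover have "B \<in> measurable M N2"
  proof (rule measurableI)
    show "B \<omega> \<in> space N2" if "\<omega> \<in> space M" for \<omega>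
      using measurable_space[OF B] that by (simp add: space_measure_of_conv)
    show "B -` S \<inter> space M \<in> events" if "S \<in> sets N2" for S
      using B'[OF that] sub[OF I(2)] by blast
  qed
  ultimately show ?thesis by (simp add: independent_rvs_def)
qed

text \<open>
  When the denominator is below \<open>c / 2\<close>, the last term is at least \<open>1\<close> and pays for the trivial bound;
  this is Chebyshev's inequality made pointwise.
\<close>

lemma kernel_weights_square_le:
  fixes K :: "'i \<Rightarrow> real"
  assumes "finite I" "\<And>i. i \<in> I \<Longrightarrow> 0 \<le> K i" "0 < c"
  shows "(\<Sum>i\<in>I. (K i / sum K I)\<^sup>2) \<le> 4 / c\<^sup>2 * (\<Sum>i\<in>I. (K i)\<^sup>2) + 4 * (sum K I / c - 1)\<^sup>2"
proof (cases "sum K I \<ge> c / 2")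
  case True
  have "(\<Sum>i\<in>I. (K i / sum K I)\<^sup>2) = (\<Sum>i\<in>I. (K i)\<^sup>2) / (sum K I)\<^sup>2"
    by (simp add: power_divide sum_divide_distrib)
  also have "\<dots> \<le> (\<Sum>i\<in>I. (K i)\<^sup>2) / (c / 2)\<^sup>2"
    using True assms by (intro divide_left_mono power_mono mult_pos_pos sum_nonneg) auto
  also have "\<dots> = 4 / c\<^sup>2 * (\<Sum>i\<in>I. (K i)\<^sup>2)" by (simp add: power_divide)
  finally show ?thesis by (simp add: add_increasing2)
next
  case False
  have S: "0 \<le> sum K I" using assms by (simp add: sum_nonneg)
  have "(K i / sum K I)\<^sup>2 \<le> K i / sum K I" if "i \<in> I" for i
  proof -
    have "K i \<le> sum K I" using assms that by (intro member_le_sum) auto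
    then have "0 \<le> K i / sum K I" "K i / sum K I \<le> 1"
      using assms(2)[OF that] S by (auto simp: divide_le_eq_1)
    then show ?thesis unfolding power2_eq_square by (intro mult_left_le)
  qed
  then have "(\<Sum>i\<in>I. (K i / sum K I)\<^sup>2) \<le> sum K I / sum K I"
    unfolding sum_divide_distrib by (rule sum_mono)
  \<comment> \<open>The quotient is 1, or 0 when the denominator vanishes.\<close>
  also have "\<dots> \<le> 4 * (1 / 2)\<^sup>2" by (simp add: power2_eq_square)
  also have "\<dots> \<le> 4 * (1 - sum K I / c)\<^sup>2"
    using False \<open>0 < c\<close> by (intro mult_left_mono power_mono) (auto simp: field_simps)
  also have "\<dots> = 4 * (sum K I / c - 1)\<^sup>2" by (simp add: power2_commute)
  finally show ?thesis using assms by (simp add: add_increasing sum_nonneg)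
qed

text \<open>The same dichotomy at c / 2. Above it, Cauchy-Schwarz with weights \<open>K\<close>
  applies; below it, the average is bounded by \<open>B\<close> (it is 0 for a vanishing
  denominator), so the error is at most 2B.\<close>

lemma kernel_average_bias_le:
  fixes K f :: "'i \<Rightarrow> real"
  assumes "finite I" "\<And>i. i \<in> I \<Longrightarrow> 0 \<le> K i" "0 < c"
    and f: "\<And>i. i \<in> I \<Longrightarrow> \<bar>f i\<bar> \<le> B" and y: "\<bar>y\<bar> \<le> B"
  shows "((\<Sum>i\<in>I. f i * K i) / sum K I - y)\<^sup>2
     \<le> 2 / c * (\<Sum>i\<in>I. K i * (f i - y)\<^sup>2) + 16 * B\<^sup>2 * (sum K I / c - 1)\<^sup>2"
proof (cases "sum K I \<ge> c / 2")
  case True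
  then have S: "0 < sum K I" using \<open>0 < c\<close> by linarith
  have "(\<Sum>i\<in>I. f i * K i) / sum K I - y = (\<Sum>i\<in>I. K i * (f i - y)) / sum K I"
    using S by (simp add: field_simps sum_distrib_left sum_subtractf)
  then have "((\<Sum>i\<in>I. f i * K i) / sum K I - y)\<^sup>2
     = (\<Sum>i\<in>I. sqrt (K i) * (sqrt (K i) * (f i - y)))\<^sup>2 / (sum K I)\<^sup>2"
    using assms(2) by (simp add: power_divide mult.assoc[symmetric])
  also have "\<dots> \<le> (\<Sum>i\<in>I. (sqrt (K i))\<^sup>2) * (\<Sum>i\<in>I. (sqrt (K i) * (f i - y))\<^sup>2) / (sum K I)\<^sup>2"
    by (intro divide_right_mono Cauchy_Schwarz_ineq_sum) simp
  also have "\<dots> = sum K I * (\<Sum>i\<in>I. K i * (f i - y)\<^sup>2) / (sum K I)\<^sup>2"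
    using assms(2) by (simp add: power_mult_distrib)
  also have "\<dots> = (\<Sum>i\<in>I. K i * (f i - y)\<^sup>2) / sum K I"
    using S by (simp add: power2_eq_square)
  also have "\<dots> \<le> (\<Sum>i\<in>I. K i * (f i - y)\<^sup>2) / (c / 2)"
    using True assms by (intro divide_left_mono sum_nonneg) auto
  also have "\<dots> = 2 / c * (\<Sum>i\<in>I. K i * (f i - y)\<^sup>2)" by simp
  finally show ?thesis by (simp add: add_increasing2)
next
  case False
  have S: "0 \<le> sum K I" using assms by (simp add: sum_nonneg)
  have B: "0 \<le> B" using y by linarith
  have "\<bar>\<Sum>i\<in>I. f i * K i\<bar> \<le> (\<Sum>i\<in>I. B * K i)"
    using assms by (intro order.trans[OF sum_abs] sum_mono) (auto simp: abs_mult intro!: mult_right_mono)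
  then have "\<bar>\<Sum>i\<in>I. f i * K i\<bar> \<le> B * sum K I" by (simp add: sum_distrib_left)
  then have "\<bar>(\<Sum>i\<in>I. f i * K i) / sum K I\<bar> \<le> B"
    using S B by (cases "sum K I = 0") (auto simp: divide_le_eq)
  then have "\<bar>(\<Sum>i\<in>I. f i * K i) / sum K I - y\<bar> \<le> 2 * B" using y by linarith
  then have "\<bar>(\<Sum>i\<in>I. f i * K i) / sum K I - y\<bar>\<^sup>2 \<le> (2 * B)\<^sup>2" by (intro power_mono) auto
  \<comment> \<open>The factor 1/4 is split off because the deviation \<open>1 - sum K I / c\<close>
    exceeds 1/2 in this case; hence the constant 16.\<close>
  also have "\<dots> = 16 * B\<^sup>2 * (1 / 2)\<^sup>2" by (simp add: power2_eq_square)
  also have "\<dots> \<le> 16 * B\<^sup>2 * (1 - sum K I / c)\<^sup>2"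
    using False \<open>0 < c\<close> by (intro mult_left_mono power_mono) (auto simp: field_simps)
  also have "\<dots> = 16 * B\<^sup>2 * (sum K I / c - 1)\<^sup>2" by (simp add: power2_commute)
  finally have "((\<Sum>i\<in>I. f i * K i) / sum K I - y)\<^sup>2 \<le> 16 * B\<^sup>2 * (sum K I / c - 1)\<^sup>2" by simp
  moreover have "0 \<le> 2 / c * (\<Sum>i\<in>I. K i * (f i - y)\<^sup>2)"
    using assms by (intro mult_nonneg_nonneg sum_nonneg) auto
  ultimately show ?thesis by linarith
qed

lemma (in prob_space) expectation_le_of_nn_integral:
  fixes u :: "'a \<Rightarrow> real"
  assumes "u \<in> borel_measurable M" "\<And>\<omega>. 0 \<le> u \<omega>" "(\<integral>\<^sup>+\<omega>. ennreal (u \<omega>) \<partial>M) \<le> ennreal a" "0 \<le> a"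
  shows "integrable M u" "expectation u \<le> a"
proof -
  show int: "integrable M u"
    using assms by (intro integrableI_nonneg) (auto intro: le_less_trans)
  show "expectation u \<le> a"
    using assms int by (simp add: nn_integral_eq_integral)
qed

section \<open>The risk for an independent sample\<close>

lemma measurable_sigma_preimages:
  assumes "\<G> \<subseteq> Pow \<Omega>" "\<And>S. S \<in> sets N \<Longrightarrow> X -` S \<inter> \<Omega> \<in> \<G>" "X \<in> \<Omega> \<rightarrow> space N"
  shows "X \<in> measurable (sigma \<Omega> \<G>) N"
  using assms by (intro measurableI) (auto simp: space_measure_of_conv)

lemma Int_stable_preimages: "Int_stable {X -` S \<inter> \<Omega> | S. S \<in> sets N}"
proof (rule Int_stableI)
  fix a b assume "a \<in> {X -` S \<inter> \<Omega> | S. S \<in> sets N}" "b \<in> {X -` S \<inter> \<Omega> | S. S \<in> sets N}"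
  then obtain S T where "S \<in> sets N" "T \<in> sets N" "a = X -` S \<inter> \<Omega>" "b = X -` T \<inter> \<Omega>"
    by blast
  then have "a \<inter> b = X -` (S \<inter> T) \<inter> \<Omega>" "S \<inter> T \<in> sets N" by auto
  then show "a \<inter> b \<in> {X -` S \<inter> \<Omega> | S. S \<in> sets N}" by blast
qed

text \<open>
  Index \<open>0\<close> is the test point, the indices \<open>1, \<dots>, n\<close> form the training set.
\<close>

locale noisy_sample = prob_space M for M :: "'w measure" +
  fixes n :: nat and \<xi> :: "nat \<Rightarrow> 'w \<Rightarrow> real^'d::finite" and \<eta> :: "nat \<Rightarrow> 'w \<Rightarrow> real" and \<sigma> :: real
  assumes indep: "indep_sets (\<lambda>(i, b). if b then {\<xi> i -` S \<inter> space M | S. S \<in> sets borel}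
      else {\<eta> i -` S \<inter> space M | S. S \<in> sets borel}) ({0..n} \<times> UNIV)"
    and \<xi>_measurable: "\<And>i. i \<le> n \<Longrightarrow> \<xi> i \<in> borel_measurable M"
    and \<eta>_measurable: "\<And>i. i \<le> n \<Longrightarrow> \<eta> i \<in> borel_measurable M"
    and distr_\<xi>: "\<And>i. i \<le> n \<Longrightarrow> distr M borel (\<xi> i) = unif"
    and \<xi>_0: "\<And>\<omega>. \<omega> \<in> space M \<Longrightarrow> \<xi> 0 \<omega> \<in> cbox 0 1"
    and \<eta>_integrable: "\<And>i. i \<le> n \<Longrightarrow> integrable M (\<lambda>\<omega>. (\<eta> i \<omega>)\<^sup>2)"
    and \<eta>_centered: "\<And>i. i \<le> n \<Longrightarrow> expectation (\<eta> i) = 0"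
    and \<eta>_square: "\<And>i. i \<le> n \<Longrightarrow> expectation (\<lambda>\<omega>. (\<eta> i \<omega>)\<^sup>2) = \<sigma>\<^sup>2"
begin

text \<open>Points and noise have different value types, so their joint independence is stated for
  the events they generate: \<open>(i, True)\<close> stands for a point, \<open>(i, False)\<close>
  for a noise variable.\<close>

definition coord_events :: "nat \<times> bool \<Rightarrow> 'w set set" where
  "coord_events = (\<lambda>(i, b). if b then {\<xi> i -` S \<inter> space M | S. S \<in> sets borel}
      else {\<eta> i -` S \<inter> space M | S. S \<in> sets borel})"

lemma indep_coord_events: "indep_sets coord_events ({0..n} \<times> UNIV)"
  using indep unfolding coord_events_def .

lemma coord_events_simps:
  "coord_events (i, True) = {\<xi> i -` S \<inter> space M | S. S \<in> sets borel}"
  "coord_events (i, False) = {\<eta> i -` S \<inter> space M | S. S \<in> sets borel}"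
  by (simp_all add: coord_events_def)

lemma coord_events_Pow: "coord_events p \<subseteq> Pow (space M)"
  by (cases p; cases "snd p") (auto simp: coord_events_simps)

lemma coord_events_Int_stable: "Int_stable (coord_events p)"
  by (cases p; cases "snd p") (auto simp: coord_events_simps Int_stable_preimages)

lemma indep_vars_coord:
  "indep_vars (\<lambda>_. borel) \<xi> {0..n}" "indep_vars (\<lambda>_. borel) \<eta> {0..n}"
proof -
  have *: "prob (\<Inter>j\<in>J. A j) = (\<Prod>j\<in>J. prob (A j))"
    if "J \<noteq> {}" "J \<subseteq> {0..n}" "finite J" "\<And>j. j \<in> J \<Longrightarrow> A j \<in> coord_events (j, b)" for J A b
  proof -
    have "J \<times> {b} = (\<lambda>j. (j, b)) ` J" by auto
    moreover have "prob (\<Inter>p\<in>J \<times> {b}. A (fst p)) = (\<Prod>p\<in>J \<times> {b}. prob (A (fst p)))"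
      by (rule indep_setsD[OF indep_coord_events]) (use that in auto)
    ultimately show ?thesis by (simp add: prod.reindex inj_on_def)
  qed
  show "indep_vars (\<lambda>_. borel) \<xi> {0..n}" unfolding indep_vars_def2
  proof (intro conjI ballI indep_setsI)
    fix A J assume "J \<noteq> {}" "J \<subseteq> {0..n}" "finite J" "\<forall>j\<in>J. A j \<in> {\<xi> j -` S \<inter> space M | S. S \<in> sets borel}"
    then show "prob (\<Inter>j\<in>J. A j) = (\<Prod>j\<in>J. prob (A j))"
      by (intro *[of J A True]) (auto simp: coord_events_simps)
  qed (use \<xi>_measurable in auto)
  show "indep_vars (\<lambda>_. borel) \<eta> {0..n}" unfolding indep_vars_def2
  proof (intro conjI ballI indep_setsI)
    fix A J assume "J \<noteq> {}" "J \<subseteq> {0..n}" "finite J" "\<forall>j\<in>J. A j \<in> {\<eta> j -` S \<inter> space M | S. S \<in> sets borel}"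
    then show "prob (\<Inter>j\<in>J. A j) = (\<Prod>j\<in>J. prob (A j))"
      by (intro *[of J A False]) (auto simp: coord_events_simps)
  qed (use \<eta>_measurable in auto)
qed

lemma coord_measurable_sigma:
  assumes "(i, True) \<in> I"
  shows "\<xi> i \<in> measurable (sigma (space M) (\<Union>p\<in>I. coord_events p)) borel"
proof (rule measurable_sigma_preimages)
  show "\<xi> i -` S \<inter> space M \<in> (\<Union>p\<in>I. coord_events p)" if "S \<in> sets borel" for S
    by (rule UN_I[OF assms]) (use that in \<open>auto simp: coord_events_simps\<close>)
qed (use coord_events_Pow in auto)

lemma noise_measurable_sigma:
  assumes "(i, False) \<in> I"
  shows "\<eta> i \<in> measurable (sigma (space M) (\<Union>p\<in>I. coord_events p)) borel"
proof (rule measurable_sigma_preimages)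
  show "\<eta> i -` S \<inter> space M \<in> (\<Union>p\<in>I. coord_events p)" if "S \<in> sets borel" for S
    by (rule UN_I[OF assms]) (use that in \<open>auto simp: coord_events_simps\<close>)
qed (use coord_events_Pow in auto)

lemma independent_points_noise:
  "independent_rvs M (PiM {0..n} (\<lambda>_. borel)) (\<lambda>\<omega>. \<lambda>i\<in>{0..n}. \<xi> i \<omega>)
     (PiM {1..n} (\<lambda>_. borel)) (\<lambda>\<omega>. \<lambda>i\<in>{1..n}. \<eta> i \<omega>)"
  by (rule independent_rvs_collect[OF indep_coord_events, of "{0..n} \<times> {True}" "{1..n} \<times> {False}"])
    (auto intro!: measurable_restrict coord_measurable_sigma noise_measurable_sigma coord_events_Int_stable)

lemma independent_test_training:
  "independent_rvs M borel (\<xi> 0) (PiM {1..n} (\<lambda>_. borel)) (\<lambda>\<omega>. \<lambda>i\<in>{1..n}. \<xi> i \<omega>)"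
  by (rule independent_rvs_collect[OF indep_coord_events, of "{(0, True)}" "{1..n} \<times> {True}"])
    (auto intro!: measurable_restrict coord_measurable_sigma coord_events_Int_stable
        coord_measurable_sigma[of 0 "{(0, True)}", simplified])

lemma independent_test_point:
  assumes "i \<in> {1..n}"
  shows "independent_rvs M borel (\<xi> 0) borel (\<xi> i)"
  by (rule independent_rvs_collect[OF indep_coord_events, of "{(0, True)}" "{(i, True)}"])
    (use assms in \<open>auto intro!: coord_events_Int_stable
        coord_measurable_sigma[of _ "{(_, True)}", simplified]\<close>)

lemma integrable_point:
  fixes u :: "real^'d \<Rightarrow> real"
  assumes "i \<le> n" "u \<in> borel_measurable borel"
  shows "integrable M (\<lambda>\<omega>. u (\<xi> i \<omega>)) \<longleftrightarrow> integrable unif u"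
  using assms \<xi>_measurable[OF assms(1)] by (simp add: integrable_distr_eq flip: distr_\<xi>[OF assms(1)])

lemma expectation_point:
  fixes u :: "real^'d \<Rightarrow> real"
  assumes "i \<le> n" "u \<in> borel_measurable borel"
  shows "expectation (\<lambda>\<omega>. u (\<xi> i \<omega>)) = (\<integral>z. u z \<partial>unif)"
  using assms \<xi>_measurable[OF assms(1)] by (simp add: integral_distr flip: distr_\<xi>[OF assms(1)])

text \<open>Freezing the test point reduces a joint expectation to an integral over the cube that is
  bounded uniformly in the test point.\<close>

lemma nn_integral_pair_le:
  fixes h :: "real^'d \<Rightarrow> real^'d \<Rightarrow> real"
  assumes i: "i \<in> {1..n}" and h [measurable]: "case_prod h \<in> borel_measurable (borel \<Otimes>\<^sub>M borel)"
    and nonneg: "\<And>x z. 0 \<le> h x z"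
    and int: "\<And>x. x \<in> cbox 0 1 \<Longrightarrow> integrable unif (h x)"
    and bound: "\<And>x. x \<in> cbox 0 1 \<Longrightarrow> (\<integral>z. h x z \<partial>unif) \<le> C"
  shows "(\<integral>\<^sup>+\<omega>. ennreal (h (\<xi> 0 \<omega>) (\<xi> i \<omega>)) \<partial>M) \<le> ennreal C"
proof -
  have "(\<integral>\<^sup>+\<omega>. ennreal (h (\<xi> 0 \<omega>) (\<xi> i \<omega>)) \<partial>M)
      = (\<integral>\<^sup>+\<omega>. \<integral>\<^sup>+\<omega>'. ennreal (h (\<xi> 0 \<omega>) (\<xi> i \<omega>')) \<partial>M \<partial>M)"
    by (rule nn_integral_independent_rvs[OF independent_test_point[OF i]]) measurable
  also have "\<dots> \<le> (\<integral>\<^sup>+\<omega>. ennreal C \<partial>M)"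
  proof (rule nn_integral_mono)
    fix \<omega> assume "\<omega> \<in> space M"
    then have x: "\<xi> 0 \<omega> \<in> cbox 0 1" by (rule \<xi>_0)
    have hm: "h (\<xi> 0 \<omega>) \<in> borel_measurable borel" using measurable_Pair2[OF h] by simp
    have "i \<le> n" using i by simp
    have "(\<integral>\<^sup>+\<omega>'. ennreal (h (\<xi> 0 \<omega>) (\<xi> i \<omega>')) \<partial>M) = ennreal (\<integral>z. h (\<xi> 0 \<omega>) z \<partial>unif)"
      using int[OF x] nonneg
      by (subst nn_integral_eq_integral)
        (auto simp: integrable_point[OF \<open>i \<le> n\<close> hm] expectation_point[OF \<open>i \<le> n\<close> hm])
    also have "\<dots> \<le> ennreal C" by (rule ennreal_leI[OF bound[OF x]])
    finally show "(\<integral>\<^sup>+\<omega>'. ennreal (h (\<xi> 0 \<omega>) (\<xi> i \<omega>')) \<partial>M) \<le> ennreal C" .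
  qed
  finally show ?thesis by (simp add: emeasure_space_1)
qed

section \<open>Kernel sums and risk for fixed depth \<open>k\<close> and sample size
  \<open>n\<close>\<close>

context
  fixes k :: nat and c :: real and K :: "nat \<Rightarrow> 'w \<Rightarrow> real"
  defines "c \<equiv> real n / 2 ^ k" and "K \<equiv> \<lambda>i \<omega>. kerf_kernel k (\<xi> 0 \<omega>) (\<xi> i \<omega>)"
  assumes n: "0 < n" "2 ^ k \<le> n"
begin

text \<open>As the mean of a single kernel value is 2^-k, \<open>c\<close> is the mean of the
  denominator. Being at least 1, it lets the factor 1 / c in the variance bounds be dropped.\<close>

lemma c_ge_1: "1 \<le> c"
proof -
  have "(2 :: real) ^ k = real (2 ^ k)" by simp
  also have "\<dots> \<le> n" using n(2) by (rule of_nat_mono)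
  finally show ?thesis by (simp add: c_def)
qed

lemma K_measurable: "i \<le> n \<Longrightarrow> K i \<in> borel_measurable M"
  unfolding K_def by (intro kerf_kernel_measurable \<xi>_measurable) auto

lemma K_nonneg: "0 \<le> K i \<omega>"
  by (simp add: K_def kerf_kernel_nonneg)

lemma kernel_pair_measurable [measurable]:
  "case_prod (kerf_kernel k) \<in> borel_measurable (borel \<Otimes>\<^sub>M (borel :: (real^'d) measure))"
  unfolding case_prod_beta' by (intro kerf_kernel_measurable) auto

lemma kernel_point_measurable [measurable]:
  "kerf_kernel k x \<in> borel_measurable (borel :: (real^'d) measure)"
  by (rule kerf_kernel_measurable[where f = "\<lambda>_. x" and g = "\<lambda>z. z"]) auto

lemma kernel_decay_nonneg: "0 \<le> kernel_decay d k"
proof -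
  have "sqrt (1 / 2) < 1" by simp
  then show ?thesis unfolding kernel_decay_def kernel_const_def
    by (intro mult_nonneg_nonneg zero_le_power divide_nonneg_nonneg) auto
qed

lemma sum_K_square:
  shows "integrable M (\<lambda>\<omega>. \<Sum>i=1..n. (K i \<omega>)\<^sup>2)"
    and "expectation (\<lambda>\<omega>. \<Sum>i=1..n. (K i \<omega>)\<^sup>2) \<le> c * kernel_decay CARD('d) k"
proof -
  have *: "integrable M (\<lambda>\<omega>. (K i \<omega>)\<^sup>2) \<and>
      expectation (\<lambda>\<omega>. (K i \<omega>)\<^sup>2) \<le> (1 / 2) ^ k * kernel_decay CARD('d) k"
    if i: "i \<in> {1..n}" for i
  proof -
    have "(\<integral>\<^sup>+\<omega>. ennreal ((K i \<omega>)\<^sup>2) \<partial>M) \<le> ennreal ((1 / 2) ^ k * kernel_decay CARD('d) k)"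
      unfolding K_def
      by (rule nn_integral_pair_le[OF i, where h = "\<lambda>x z. (kerf_kernel k x z)\<^sup>2"])
        (use integral_kerf_kernel_square_le kerf_kernel_integrable(2) in auto)
    moreover have "(\<lambda>\<omega>. (K i \<omega>)\<^sup>2) \<in> borel_measurable M"
      using i by (intro borel_measurable_power K_measurable) auto
    moreover have "0 \<le> (1 / 2) ^ k * kernel_decay CARD('d) k"
      by (intro mult_nonneg_nonneg kernel_decay_nonneg) simp
    ultimately show ?thesis
      by (intro conjI expectation_le_of_nn_integral) auto
  qed
  show "integrable M (\<lambda>\<omega>. \<Sum>i=1..n. (K i \<omega>)\<^sup>2)"
    using * by (intro Bochner_Integration.integrable_sum) auto
  have "expectation (\<lambda>\<omega>. \<Sum>i=1..n. (K i \<omega>)\<^sup>2) = (\<Sum>i=1..n. expectation (\<lambda>\<omega>. (K i \<omega>)\<^sup>2))"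
    using * by (intro Bochner_Integration.integral_sum) auto
  also have "\<dots> \<le> (\<Sum>i=1..n. (1 / 2) ^ k * kernel_decay CARD('d) k)"
    using * by (intro sum_mono) auto
  also have "\<dots> = c * kernel_decay CARD('d) k" by (simp add: c_def power_one_over)
  finally show "expectation (\<lambda>\<omega>. \<Sum>i=1..n. (K i \<omega>)\<^sup>2) \<le> c * kernel_decay CARD('d) k" .
qed

lemma sum_K_dist:
  shows "integrable M (\<lambda>\<omega>. \<Sum>i=1..n. K i \<omega> * (norm (\<xi> 0 \<omega> - \<xi> i \<omega>))\<^sup>2)"
    and "expectation (\<lambda>\<omega>. \<Sum>i=1..n. K i \<omega> * (norm (\<xi> 0 \<omega> - \<xi> i \<omega>))\<^sup>2)
      \<le> c * (CARD('d) * (1 - 3 / (4 * real CARD('d))) ^ k)"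
proof -
  define D where "D = CARD('d) * (1 - 3 / (4 * real CARD('d))) ^ k"
  have "1 \<le> real CARD('d)" by (simp add: Suc_le_eq)
  then have "3 / (4 * real CARD('d)) \<le> 1" by (subst divide_le_eq_1) linarith
  then have D: "0 \<le> D" by (simp add: D_def)
  have *: "integrable M (\<lambda>\<omega>. K i \<omega> * (norm (\<xi> 0 \<omega> - \<xi> i \<omega>))\<^sup>2) \<and>
      expectation (\<lambda>\<omega>. K i \<omega> * (norm (\<xi> 0 \<omega> - \<xi> i \<omega>))\<^sup>2) \<le> (1 / 2) ^ k * D"
    if i: "i \<in> {1..n}" for i
  proof -
    have "(\<integral>\<^sup>+\<omega>. ennreal (K i \<omega> * (norm (\<xi> 0 \<omega> - \<xi> i \<omega>))\<^sup>2) \<partial>M) \<le> ennreal ((1 / 2) ^ k * D)"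
      unfolding K_def D_def
      by (rule nn_integral_pair_le[OF i, where h = "\<lambda>x z. kerf_kernel k x z * (norm (x - z))\<^sup>2"])
        (use integral_kerf_kernel_dist_le kerf_kernel_dist_integrable in
          \<open>auto intro!: mult_nonneg_nonneg kerf_kernel_nonneg\<close>)
    moreover have "(\<lambda>\<omega>. K i \<omega> * (norm (\<xi> 0 \<omega> - \<xi> i \<omega>))\<^sup>2) \<in> borel_measurable M"
    proof -
      have [measurable]: "\<xi> 0 \<in> borel_measurable M" "\<xi> i \<in> borel_measurable M" "K i \<in> borel_measurable M"
        using i by (auto intro: K_measurable \<xi>_measurable)
      show ?thesis by measurable
    qed
    moreover have "0 \<le> (1 / 2) ^ k * D"
      using D by (intro mult_nonneg_nonneg) auto
    ultimately show ?thesis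
      by (intro conjI expectation_le_of_nn_integral) (auto intro!: mult_nonneg_nonneg K_nonneg)
  qed
  show "integrable M (\<lambda>\<omega>. \<Sum>i=1..n. K i \<omega> * (norm (\<xi> 0 \<omega> - \<xi> i \<omega>))\<^sup>2)"
    using * by (intro Bochner_Integration.integrable_sum) auto
  have "expectation (\<lambda>\<omega>. \<Sum>i=1..n. K i \<omega> * (norm (\<xi> 0 \<omega> - \<xi> i \<omega>))\<^sup>2)
      = (\<Sum>i=1..n. expectation (\<lambda>\<omega>. K i \<omega> * (norm (\<xi> 0 \<omega> - \<xi> i \<omega>))\<^sup>2))"
    using * by (intro Bochner_Integration.integral_sum) auto
  also have "\<dots> \<le> (\<Sum>i=1..n. (1 / 2) ^ k * D)"
    using * by (intro sum_mono) auto
  also have "\<dots> = c * D" by (simp add: c_def power_one_over)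
  finally show "expectation (\<lambda>\<omega>. \<Sum>i=1..n. K i \<omega> * (norm (\<xi> 0 \<omega> - \<xi> i \<omega>))\<^sup>2)
      \<le> c * (CARD('d) * (1 - 3 / (4 * real CARD('d))) ^ k)" by (simp add: D_def)
qed

text \<open>Given the test point, each \<open>K i / c\<close> has mean 1 / n, so the deviation is a
  sum of independent centered terms. Each has variance at most 2^-k \<open>kernel_decay\<close> /
  c^2, and 2^-k = c / n turns the sum over \<open>n\<close> terms into \<open>kernel_decay\<close> /
  c.\<close>

lemma kernel_sum_deviation:
  shows "integrable M (\<lambda>\<omega>. ((\<Sum>i=1..n. K i \<omega>) / c - 1)\<^sup>2)"
    and "expectation (\<lambda>\<omega>. ((\<Sum>i=1..n. K i \<omega>) / c - 1)\<^sup>2) \<le> kernel_decay CARD('d) k / c"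
proof -
  have c: "0 < c" using c_ge_1 by linarith
  define g where "g = (\<lambda>(i::nat) (x :: real^'d) z. kerf_kernel k x z / c - 1 / real n)"
  have eq: "(\<Sum>i=1..n. K i \<omega>) / c - 1 = (\<Sum>i=1..n. g i (\<xi> 0 \<omega>) (\<xi> i \<omega>))" for \<omega>
    using n by (simp add: g_def K_def sum_subtractf sum_divide_distrib)
  interpret U: prob_space "unif :: (real^'d) measure" by (rule prob_space_unif)
  have sq: "integrable unif (\<lambda>z. (g i x z)\<^sup>2)" for i x
    unfolding g_def power2_diff power_divide
    by (intro Bochner_Integration.integrable_add Bochner_Integration.integrable_diff integrable_divide
        integrable_mult_left integrable_mult_right kerf_kernel_integrable) auto
  have gm: "g i x \<in> borel_measurable borel" for i x
    unfolding g_def by measurable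
  have mean: "(\<integral>z. g i x z \<partial>unif) = 0" if "x \<in> cbox 0 1" for i x
    using n by (simp add: g_def integral_kerf_kernel[OF that] kerf_kernel_integrable U.prob_space[simplified] c_def power_one_over)
  have var: "(\<integral>z. (g i x z)\<^sup>2 \<partial>unif) \<le> kernel_decay CARD('d) k / (c * n)" if "x \<in> cbox 0 1" for i x
  proof -
    \<comment> \<open>The square is expanded in terms of \<open>g\<close> itself, so that the linear
      part vanishes by centering.\<close>
    have "(\<integral>z. (g i x z)\<^sup>2 \<partial>unif)
        = (\<integral>z. (kerf_kernel k x z)\<^sup>2 / c\<^sup>2 - 1 / real n * (2 * g i x z + 1 / real n) \<partial>unif)"
      by (intro Bochner_Integration.integral_cong refl) (simp add: g_def power2_eq_square algebra_simps)
    also have "\<dots> = (\<integral>z. (kerf_kernel k x z)\<^sup>2 \<partial>unif) / c\<^sup>2 - 1 / real n * (1 / real n)"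
    proof -
      have "integrable unif (g i x)" unfolding g_def
        by (intro Bochner_Integration.integrable_diff integrable_divide kerf_kernel_integrable) auto
      then show ?thesis
        using mean[OF that] kerf_kernel_integrable(2)[of k x] by (simp add: U.prob_space[simplified])
    qed
    also have "\<dots> \<le> (1 / 2) ^ k * kernel_decay CARD('d) k / c\<^sup>2"
    proof -
      have "(\<integral>z. (kerf_kernel k x z)\<^sup>2 \<partial>unif) / c\<^sup>2 \<le> (1 / 2) ^ k * kernel_decay CARD('d) k / c\<^sup>2"
        by (intro divide_right_mono integral_kerf_kernel_square_le that) simp
      moreover have "0 \<le> 1 / real n * (1 / real n)" by simp
      ultimately show ?thesis by linarith
    qed
    also have "\<dots> = kernel_decay CARD('d) k / (c * n)"
      using n by (simp add: c_def power2_eq_square power_one_over field_simps)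
    finally show ?thesis .
  qed
  have "(\<integral>\<^sup>+\<omega>. ennreal ((\<Sum>i=1..n. g i (\<xi> 0 \<omega>) (\<xi> i \<omega>))\<^sup>2) \<partial>M)
      \<le> (\<integral>\<^sup>+\<omega>. ennreal (kernel_decay CARD('d) k / c) \<partial>M)"
  proof (rule nn_integral_square_sum_centered_le[OF _ independent_test_training])
    show "indep_vars (\<lambda>_. borel) \<xi> {1..n}"
      by (rule indep_vars_subset[OF indep_vars_coord(1)]) auto
    fix i assume "i \<in> {1..n}"
    then have i: "i \<le> n" by simp
    show "case_prod (g i) \<in> borel_measurable (borel \<Otimes>\<^sub>M borel)"
      unfolding g_def by measurable
    fix \<omega> assume \<omega>: "\<omega> \<in> space M"
    show "integrable M (\<lambda>\<omega>'. (g i (\<xi> 0 \<omega>) (\<xi> i \<omega>'))\<^sup>2)"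
      by (subst integrable_point[OF i]) (use gm sq in auto)
    show "expectation (\<lambda>\<omega>'. g i (\<xi> 0 \<omega>) (\<xi> i \<omega>')) = 0"
      by (subst expectation_point[OF i]) (use gm mean[OF \<xi>_0[OF \<omega>]] in auto)
  next
    fix \<omega> assume \<omega>: "\<omega> \<in> space M"
    have "(\<Sum>i=1..n. expectation (\<lambda>\<omega>'. (g i (\<xi> 0 \<omega>) (\<xi> i \<omega>'))\<^sup>2))
        \<le> (\<Sum>i=1..n. kernel_decay CARD('d) k / (c * n))"
    proof (rule sum_mono)
      fix i assume "i \<in> {1..n}"
      then have i: "i \<le> n" by simp
      show "expectation (\<lambda>\<omega>'. (g i (\<xi> 0 \<omega>) (\<xi> i \<omega>'))\<^sup>2) \<le> kernel_decay CARD('d) k / (c * n)"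
        by (subst expectation_point[OF i]) (use gm var[OF \<xi>_0[OF \<omega>]] in auto)
    qed
    then show "(\<Sum>i=1..n. expectation (\<lambda>\<omega>'. (g i (\<xi> 0 \<omega>) (\<xi> i \<omega>'))\<^sup>2)) \<le> kernel_decay CARD('d) k / c"
      using n by simp
  qed auto
  then have le: "(\<integral>\<^sup>+\<omega>. ennreal (((\<Sum>i=1..n. K i \<omega>) / c - 1)\<^sup>2) \<partial>M) \<le> ennreal (kernel_decay CARD('d) k / c)"
    unfolding eq by (simp add: emeasure_space_1)
  have meas: "(\<lambda>\<omega>. ((\<Sum>i=1..n. K i \<omega>) / c - 1)\<^sup>2) \<in> borel_measurable M"
    using K_measurable by (intro borel_measurable_power borel_measurable_diff borel_measurable_divide
        borel_measurable_sum) auto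
  show "integrable M (\<lambda>\<omega>. ((\<Sum>i=1..n. K i \<omega>) / c - 1)\<^sup>2)"
    "expectation (\<lambda>\<omega>. ((\<Sum>i=1..n. K i \<omega>) / c - 1)\<^sup>2) \<le> kernel_decay CARD('d) k / c"
    using expectation_le_of_nn_integral[OF meas _ le] c kernel_decay_nonneg by auto
qed

text \<open>Given all points the weights are fixed, and the second moment is \<sigma>^2 times the
  sum of squared weights. Both terms of \<open>kernel_weights_square_le\<close> contribute 4
  \<open>kernel_decay\<close> / c, whence the constant 8.\<close>

lemma noise_average:
  shows "integrable M (\<lambda>\<omega>. (\<Sum>i=1..n. K i \<omega> / (\<Sum>j=1..n. K j \<omega>) * \<eta> i \<omega>)\<^sup>2)"
    and "expectation (\<lambda>\<omega>. (\<Sum>i=1..n. K i \<omega> / (\<Sum>j=1..n. K j \<omega>) * \<eta> i \<omega>)\<^sup>2)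
      \<le> 8 * \<sigma>\<^sup>2 * kernel_decay CARD('d) k"
proof -
  define \<rho> where "\<rho> = kernel_decay CARD('d) k"
  have c: "0 < c" using c_ge_1 by linarith
  define T where "T = (\<lambda>\<omega>. \<lambda>i\<in>{0..n}. \<xi> i \<omega>)"
  define g where "g = (\<lambda>(i::nat) (t :: nat \<Rightarrow> real^'d) (v :: real).
    kerf_kernel k (t 0) (t i) / (\<Sum>j=1..n. kerf_kernel k (t 0) (t j)) * v)"
  define b where "b = (\<lambda>\<omega>. \<sigma>\<^sup>2 * (4 / c\<^sup>2 * (\<Sum>i=1..n. (K i \<omega>)\<^sup>2) + 4 * ((\<Sum>i=1..n. K i \<omega>) / c - 1)\<^sup>2))"
  have g_eq: "g i (T \<omega>) v = K i \<omega> / (\<Sum>j=1..n. K j \<omega>) * v" if "i \<in> {1..n}" for i \<omega> v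
    using that by (simp add: g_def T_def K_def)
  have "(\<integral>\<^sup>+\<omega>. ennreal ((\<Sum>i=1..n. g i (T \<omega>) (\<eta> i \<omega>))\<^sup>2) \<partial>M) \<le> (\<integral>\<^sup>+\<omega>. ennreal (b \<omega>) \<partial>M)"
  proof (rule nn_integral_square_sum_centered_le[OF _ independent_points_noise[folded T_def]])
    show "indep_vars (\<lambda>_. borel) \<eta> {1..n}"
      by (rule indep_vars_subset[OF indep_vars_coord(2)]) auto
    fix i assume i: "i \<in> {1..n}"
    have comp: "(\<lambda>p. fst p j) \<in> borel_measurable (PiM {0..n} (\<lambda>_. borel :: (real^'d) measure) \<Otimes>\<^sub>M (borel :: real measure))"
      if "j \<in> {0..n}" for j
      by (rule measurable_compose[OF measurable_fst measurable_component_singleton[OF that]])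
    show "case_prod (g i) \<in> borel_measurable (PiM {0..n} (\<lambda>_. borel) \<Otimes>\<^sub>M borel)"
      unfolding g_def case_prod_beta' using i
      by (intro borel_measurable_times borel_measurable_divide borel_measurable_sum
          kerf_kernel_measurable comp) auto
    fix \<omega> assume "\<omega> \<in> space M"
    show "integrable M (\<lambda>\<omega>'. (g i (T \<omega>) (\<eta> i \<omega>'))\<^sup>2)"
      unfolding g_eq[OF i] power_mult_distrib
      by (intro integrable_mult_right \<eta>_integrable) (use i in auto)
    show "expectation (\<lambda>\<omega>'. g i (T \<omega>) (\<eta> i \<omega>')) = 0"
      using i \<eta>_centered[of i] by (simp add: g_eq)
  next
    fix \<omega> assume "\<omega> \<in> space M"
    have "(\<Sum>i=1..n. expectation (\<lambda>\<omega>'. (g i (T \<omega>) (\<eta> i \<omega>'))\<^sup>2))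
        = \<sigma>\<^sup>2 * (\<Sum>i=1..n. (K i \<omega> / (\<Sum>j=1..n. K j \<omega>))\<^sup>2)"
      unfolding sum_distrib_left
    proof (intro sum.cong refl)
      fix i assume i: "i \<in> {1..n}"
      show "expectation (\<lambda>\<omega>'. (g i (T \<omega>) (\<eta> i \<omega>'))\<^sup>2) = \<sigma>\<^sup>2 * (K i \<omega> / (\<Sum>j=1..n. K j \<omega>))\<^sup>2"
        unfolding g_eq[OF i] power_mult_distrib integral_mult_right_zero
        using i by (subst \<eta>_square) auto
    qed
    also have "\<dots> \<le> b \<omega>"
      unfolding b_def using c K_nonneg by (intro mult_left_mono kernel_weights_square_le) auto
    finally show "(\<Sum>i=1..n. expectation (\<lambda>\<omega>'. (g i (T \<omega>) (\<eta> i \<omega>'))\<^sup>2)) \<le> b \<omega>" .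
  qed simp
  also have "\<dots> = ennreal (expectation b)"
    using sum_K_square(1) kernel_sum_deviation(1) unfolding b_def
    by (intro nn_integral_eq_integral) (auto intro!: AE_I2 add_nonneg_nonneg mult_nonneg_nonneg divide_nonneg_nonneg sum_nonneg)
  also have "\<dots> \<le> ennreal (8 * \<sigma>\<^sup>2 * \<rho>)"
  proof (rule ennreal_leI)
    have "expectation b = \<sigma>\<^sup>2 * (4 / c\<^sup>2 * expectation (\<lambda>\<omega>. \<Sum>i=1..n. (K i \<omega>)\<^sup>2)
        + 4 * expectation (\<lambda>\<omega>. ((\<Sum>i=1..n. K i \<omega>) / c - 1)\<^sup>2))"
      unfolding b_def using sum_K_square(1) kernel_sum_deviation(1) by simp
    also have "\<dots> \<le> \<sigma>\<^sup>2 * (4 / c\<^sup>2 * (c * \<rho>) + 4 * (\<rho> / c))"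
      using sum_K_square(2) kernel_sum_deviation(2) unfolding \<rho>_def
      by (intro mult_left_mono add_mono) auto
    also have "\<dots> = 8 * \<sigma>\<^sup>2 * (\<rho> / c)"
      using c by (simp add: power2_eq_square)
    also have "\<dots> \<le> 8 * \<sigma>\<^sup>2 * (\<rho> / 1)"
      using c_ge_1 kernel_decay_nonneg[of "CARD('d)"] unfolding \<rho>_def
      by (intro mult_left_mono divide_left_mono) auto
    finally show "expectation b \<le> 8 * \<sigma>\<^sup>2 * \<rho>" by simp
  qed
  also have "(\<integral>\<^sup>+\<omega>. ennreal ((\<Sum>i=1..n. g i (T \<omega>) (\<eta> i \<omega>))\<^sup>2) \<partial>M)
      = (\<integral>\<^sup>+\<omega>. ennreal ((\<Sum>i=1..n. K i \<omega> / (\<Sum>j=1..n. K j \<omega>) * \<eta> i \<omega>)\<^sup>2) \<partial>M)"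
    by (simp only: g_eq cong: sum.cong)
  finally have le: "(\<integral>\<^sup>+\<omega>. ennreal ((\<Sum>i=1..n. K i \<omega> / (\<Sum>j=1..n. K j \<omega>) * \<eta> i \<omega>)\<^sup>2) \<partial>M)
      \<le> ennreal (8 * \<sigma>\<^sup>2 * \<rho>)" .
  have meas: "(\<lambda>\<omega>. (\<Sum>i=1..n. K i \<omega> / (\<Sum>j=1..n. K j \<omega>) * \<eta> i \<omega>)\<^sup>2) \<in> borel_measurable M"
    using K_measurable \<eta>_measurable
    by (intro borel_measurable_power borel_measurable_times borel_measurable_divide borel_measurable_sum) auto
  show "integrable M (\<lambda>\<omega>. (\<Sum>i=1..n. K i \<omega> / (\<Sum>j=1..n. K j \<omega>) * \<eta> i \<omega>)\<^sup>2)"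
    "expectation (\<lambda>\<omega>. (\<Sum>i=1..n. K i \<omega> / (\<Sum>j=1..n. K j \<omega>) * \<eta> i \<omega>)\<^sup>2)
      \<le> 8 * \<sigma>\<^sup>2 * kernel_decay CARD('d) k"
    using expectation_le_of_nn_integral[OF meas _ le] kernel_decay_nonneg by (auto simp: \<rho>_def)
qed

text \<open>The error is noise average plus bias. The inequality (a + b)^2 \<le> 2 a^2 + 2 b^2
  doubles the constants 8, 16 and 2 of the noise, deviation and Lipschitz bounds to 16, 32 and
  4.\<close>

lemma kerf_risk:
  fixes f :: "real^'d \<Rightarrow> real" and B L :: real
  assumes f: "f \<in> borel_measurable borel" and B: "\<And>z. \<bar>f z\<bar> \<le> B"
    and L: "\<And>x z. x \<in> cbox 0 1 \<Longrightarrow> z \<in> cbox 0 1 \<Longrightarrow> \<bar>f x - f z\<bar> \<le> L * norm (x - z)"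
  defines "err \<equiv> \<lambda>\<omega>. (infinite_kerf k n (\<lambda>i. \<xi> i \<omega>) (\<lambda>i. f (\<xi> i \<omega>) + \<eta> i \<omega>) (\<xi> 0 \<omega>) - f (\<xi> 0 \<omega>))\<^sup>2"
  shows "integrable M err"
    and "expectation err \<le> (16 * \<sigma>\<^sup>2 + 32 * B\<^sup>2) * kernel_decay CARD('d) k
      + 4 * L\<^sup>2 * (CARD('d) * (1 - 3 / (4 * real CARD('d))) ^ k)"
proof -
  define \<rho> where "\<rho> = kernel_decay CARD('d) k"
  define D where "D = CARD('d) * (1 - 3 / (4 * real CARD('d))) ^ k"
  have c: "0 < c" using c_ge_1 by linarith
  define N where "N = (\<lambda>\<omega>. (\<Sum>i=1..n. K i \<omega> / (\<Sum>j=1..n. K j \<omega>) * \<eta> i \<omega>)\<^sup>2)"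
  define P where "P = (\<lambda>\<omega>. \<Sum>i=1..n. K i \<omega> * (norm (\<xi> 0 \<omega> - \<xi> i \<omega>))\<^sup>2)"
  define Q where "Q = (\<lambda>\<omega>. ((\<Sum>i=1..n. K i \<omega>) / c - 1)\<^sup>2)"
  define G where "G = (\<lambda>\<omega>. 2 * N \<omega> + 2 * (2 / c * (L\<^sup>2 * P \<omega>) + 16 * B\<^sup>2 * Q \<omega>))"
  note N = noise_average[folded N_def \<rho>_def]
  note P = sum_K_dist[folded P_def D_def]
  note Q = kernel_sum_deviation[folded Q_def \<rho>_def]
  have kerf: "infinite_kerf k n (\<lambda>i. \<xi> i \<omega>) (\<lambda>i. f (\<xi> i \<omega>) + \<eta> i \<omega>) (\<xi> 0 \<omega>)
     = (\<Sum>i=1..n. f (\<xi> i \<omega>) * K i \<omega>) / (\<Sum>i=1..n. K i \<omega>)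
       + (\<Sum>i=1..n. K i \<omega> / (\<Sum>j=1..n. K j \<omega>) * \<eta> i \<omega>)" for \<omega>
  proof -
    have K: "kerf_kernel k (\<xi> 0 \<omega>) (\<xi> i \<omega>) = K i \<omega>" for i by (simp add: K_def)
    show ?thesis unfolding infinite_kerf_def K
      unfolding sum_divide_distrib sum.distrib[symmetric]
      by (intro sum.cong refl) (simp add: distrib_right add_divide_distrib)
  qed
  have le: "err \<omega> \<le> G \<omega>" if \<omega>: "\<omega> \<in> space M" for \<omega>
  proof -
    let ?b = "(\<Sum>i=1..n. f (\<xi> i \<omega>) * K i \<omega>) / (\<Sum>i=1..n. K i \<omega>) - f (\<xi> 0 \<omega>)"
    have "K i \<omega> * (f (\<xi> i \<omega>) - f (\<xi> 0 \<omega>))\<^sup>2 \<le> L\<^sup>2 * (K i \<omega> * (norm (\<xi> 0 \<omega> - \<xi> i \<omega>))\<^sup>2)" for i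
    proof (cases "\<xi> i \<omega> \<in> cbox 0 1")
      case True
      have "\<bar>f (\<xi> i \<omega>) - f (\<xi> 0 \<omega>)\<bar>\<^sup>2 \<le> (L * norm (\<xi> i \<omega> - \<xi> 0 \<omega>))\<^sup>2"
        by (rule power_mono[OF L[OF True \<xi>_0[OF \<omega>]]]) simp
      then have "K i \<omega> * (f (\<xi> i \<omega>) - f (\<xi> 0 \<omega>))\<^sup>2 \<le> K i \<omega> * (L * norm (\<xi> 0 \<omega> - \<xi> i \<omega>))\<^sup>2"
        by (intro mult_left_mono K_nonneg) (simp add: norm_minus_commute)
      then show ?thesis by (simp add: power_mult_distrib mult.left_commute)
    next
      case False
      \<comment> \<open>Training points lie in the cube only almost surely. Outside it their weight
        vanishes, so the Lipschitz bound on the cube suffices.\<close>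
      then have "K i \<omega> = 0" by (simp add: K_def kerf_kernel_eq)
      then show ?thesis by simp
    qed
    then have "(\<Sum>i=1..n. K i \<omega> * (f (\<xi> i \<omega>) - f (\<xi> 0 \<omega>))\<^sup>2) \<le> L\<^sup>2 * P \<omega>"
      unfolding P_def sum_distrib_left by (intro sum_mono)
    then have h1: "2 / c * (\<Sum>i=1..n. K i \<omega> * (f (\<xi> i \<omega>) - f (\<xi> 0 \<omega>))\<^sup>2) \<le> 2 / c * (L\<^sup>2 * P \<omega>)"
      using c by (intro mult_left_mono) auto
    have h2: "?b\<^sup>2 \<le> 2 / c * (\<Sum>i=1..n. K i \<omega> * (f (\<xi> i \<omega>) - f (\<xi> 0 \<omega>))\<^sup>2) + 16 * B\<^sup>2 * Q \<omega>"
      unfolding Q_def by (rule kernel_average_bias_le) (use c B K_nonneg in auto)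
    have h3: "err \<omega> \<le> 2 * N \<omega> + 2 * ?b\<^sup>2"
    proof -
      have "(a + b)\<^sup>2 \<le> 2 * b\<^sup>2 + 2 * a\<^sup>2" for a b :: real
        using zero_le_power2[of "a - b"] by (simp add: power2_eq_square algebra_simps)
      from this[of ?b] show ?thesis unfolding err_def kerf N_def by (simp add: algebra_simps)
    qed
    show ?thesis unfolding G_def
      by (rule order.trans[OF h3 add_left_mono[OF mult_left_mono[OF order.trans[OF h2 add_right_mono[OF h1]]]]]) simp
  qed
  have intG: "integrable M G" using N(1) P(1) Q(1) unfolding G_def by simp
  have err_meas: "err \<in> borel_measurable M"
  proof -
    have f\<xi>: "(\<lambda>\<omega>. f (\<xi> i \<omega>)) \<in> borel_measurable M" if "i \<le> n" for i
      by (rule measurable_compose[OF \<xi>_measurable[OF that] f])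
    show ?thesis unfolding err_def kerf
      by (intro borel_measurable_power borel_measurable_diff borel_measurable_add borel_measurable_times
          borel_measurable_divide borel_measurable_sum f\<xi> K_measurable \<eta>_measurable) auto
  qed
  show int: "integrable M err"
  proof (rule Bochner_Integration.integrable_bound[OF intG err_meas], rule AE_I2)
    fix \<omega> assume "\<omega> \<in> space M"
    moreover have "0 \<le> err \<omega>" by (simp add: err_def)
    ultimately show "norm (err \<omega>) \<le> norm (G \<omega>)" using le[of \<omega>] by simp
  qed
  have "expectation err \<le> expectation G"
    using le by (intro integral_mono_AE int intG AE_I2)
  also have "\<dots> = 2 * expectation N + 2 * (2 / c * (L\<^sup>2 * expectation P) + 16 * B\<^sup>2 * expectation Q)"
    using N(1) P(1) Q(1) unfolding G_def by simp
  also have "\<dots> \<le> 2 * (8 * \<sigma>\<^sup>2 * \<rho>) + 2 * (2 / c * (L\<^sup>2 * (c * D)) + 16 * B\<^sup>2 * (\<rho> / 1))"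
  proof -
    have "\<rho> / c \<le> \<rho> / 1"
      using c_ge_1 kernel_decay_nonneg[of "CARD('d)"] unfolding \<rho>_def by (intro divide_left_mono) auto
    then have "expectation Q \<le> \<rho> / 1" using Q(2) by linarith
    then show ?thesis using N(2) P(2) c by (intro add_mono mult_left_mono) auto
  qed
  also have "\<dots> = (16 * \<sigma>\<^sup>2 + 32 * B\<^sup>2) * \<rho> + 4 * L\<^sup>2 * D"
    using c by (simp add: algebra_simps)
  finally show "expectation err \<le> (16 * \<sigma>\<^sup>2 + 32 * B\<^sup>2) * kernel_decay CARD('d) k
      + 4 * L\<^sup>2 * (CARD('d) * (1 - 3 / (4 * real CARD('d))) ^ k)" by (simp only: \<rho>_def D_def)
qed

end

end

section \<open>The regression model\<close>

lemma (in prob_space) centered_gaussian_moments: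
  assumes "centered_gaussian M \<sigma> E" "0 \<le> \<sigma>"
  shows "E \<in> borel_measurable M" "integrable M (\<lambda>\<omega>. (E \<omega>)\<^sup>2)"
    "expectation E = 0" "expectation (\<lambda>\<omega>. (E \<omega>)\<^sup>2) = \<sigma>\<^sup>2"
proof -
  have "E \<in> borel_measurable M \<and> integrable M (\<lambda>\<omega>. (E \<omega>)\<^sup>2) \<and> expectation E = 0 \<and>
    expectation (\<lambda>\<omega>. (E \<omega>)\<^sup>2) = \<sigma>\<^sup>2"
  proof (cases "\<sigma> = 0")
    case True
    then have E [measurable]: "E \<in> borel_measurable M" and ae: "AE \<omega> in M. E \<omega> = 0"
      using assms by (auto simp: centered_gaussian_def)
    have ae2: "AE \<omega> in M. (E \<omega>)\<^sup>2 = 0" using ae by eventually_elim simp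
    have "integrable M (\<lambda>\<omega>. (E \<omega>)\<^sup>2) \<longleftrightarrow> integrable M (\<lambda>\<omega>. 0 :: real)"
      by (rule integrable_cong_AE) (use ae2 in auto)
    moreover have "expectation E = expectation (\<lambda>\<omega>. 0)"
      by (rule integral_cong_AE) (use ae in auto)
    moreover have "expectation (\<lambda>\<omega>. (E \<omega>)\<^sup>2) = expectation (\<lambda>\<omega>. 0)"
      by (rule integral_cong_AE) (use ae2 in auto)
    ultimately show ?thesis using True by simp
  next
    case False
    then have \<sigma>: "0 < \<sigma>" and D: "distributed M lborel E (normal_density 0 \<sigma>)"
      using assms by (auto simp: centered_gaussian_def)
    have E: "E \<in> borel_measurable M" using distributed_measurable[OF D] by simp
    have "integrable lborel (\<lambda>x. normal_density 0 \<sigma> x * x\<^sup>2)"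
      using integrable_normal_moment[OF \<sigma>, of 0 2] by simp
    then have "integrable M (\<lambda>\<omega>. (E \<omega>)\<^sup>2)"
      by (subst distributed_integrable[OF D, symmetric]) auto
    moreover have "expectation E = 0"
      using distributed_integral[OF D, of "\<lambda>x. x"] integral_normal_moment_nz_1[OF \<sigma>, of 0] by simp
    moreover have "expectation (\<lambda>\<omega>. (E \<omega>)\<^sup>2) = \<sigma>\<^sup>2"
      using distributed_integral[OF D, of "\<lambda>x. x\<^sup>2"] integral_normal_moment_even[OF \<sigma>, of 0 1] by simp
    ultimately show ?thesis using E by simp
  qed
  then show "E \<in> borel_measurable M" "integrable M (\<lambda>\<omega>. (E \<omega>)\<^sup>2)"
    "expectation E = 0" "expectation (\<lambda>\<omega>. (E \<omega>)\<^sup>2) = \<sigma>\<^sup>2" by auto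
qed

text \<open>Merges independence within the training set with independence of the test pair from the
  whole training vector into one family, with the test pair at index 0.\<close>

lemma (in prob_space) indep_vars_insert_vector:
  fixes Z :: "nat \<Rightarrow> 'a \<Rightarrow> 'b"
  assumes "1 \<le> n" and iv: "indep_vars (\<lambda>_. N) Z {1..n}"
    and ind: "independent_rvs M (PiM {1..n} (\<lambda>_. N)) (\<lambda>\<omega>. \<lambda>i\<in>{1..n}. Z i \<omega>) N (Z 0)"
  shows "indep_vars (\<lambda>_. N) Z {0..n}"
proof -
  have Z0: "Z 0 \<in> measurable M N" and
    S: "indep_set {(\<lambda>\<omega>. \<lambda>i\<in>{1..n}. Z i \<omega>) -` S \<inter> space M | S. S \<in> sets (PiM {1..n} (\<lambda>_. N))}
         {Z 0 -` S \<inter> space M | S. S \<in> sets N}"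
    using ind by (auto simp: independent_rvs_def)
  have split: "{0..n} = insert 0 {1..n}" by auto
  have rv: "Z i \<in> measurable M N" if "i \<in> {0..n}" for i
    using that iv Z0 unfolding split indep_vars_def by auto
  have "indep_sets (\<lambda>i. {Z i -` S \<inter> space M | S. S \<in> sets N}) {0..n}"
  proof (subst indep_sets_finite)
    fix i assume "i \<in> {0..n}"
    then show "{Z i -` S \<inter> space M | S. S \<in> sets N} \<subseteq> events"
      using rv by (auto intro: measurable_sets)
    show "space M \<in> {Z i -` S \<inter> space M | S. S \<in> sets N}"
      using measurable_space[OF rv[OF \<open>i \<in> {0..n}\<close>]] by (auto intro!: exI[of _ "space N"])
  next
    show "\<forall>A\<in>Pi {0..n} (\<lambda>i. {Z i -` S \<inter> space M | S. S \<in> sets N}). prob (\<Inter> (A ` {0..n})) = (\<Prod>j\<in>{0..n}. prob (A j))" 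
    proof
      fix A assume A: "A \<in> Pi {0..n} (\<lambda>i. {Z i -` S \<inter> space M | S. S \<in> sets N})"
      have "\<forall>i\<in>{1..n}. \<exists>S. S \<in> sets N \<and> A i = Z i -` S \<inter> space M"
        using A by (fastforce simp: Pi_iff)
      then obtain S' where S': "\<And>i. i \<in> {1..n} \<Longrightarrow> S' i \<in> sets N \<and> A i = Z i -` S' i \<inter> space M"
        by (metis (no_types))
      \<comment> \<open>The joint training event is the preimage of a product set under the training
        vector, which is where independence from \<open>Z 0\<close> applies.\<close>
      have "(\<Inter>i\<in>{1..n}. A i) = (\<lambda>\<omega>. \<lambda>i\<in>{1..n}. Z i \<omega>) -` (\<Pi>\<^sub>E i\<in>{1..n}. S' i) \<inter> space M"
        using S' \<open>1 \<le> n\<close> by (auto simp: PiE_iff)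
      moreover have "(\<Pi>\<^sub>E i\<in>{1..n}. S' i) \<in> sets (PiM {1..n} (\<lambda>_. N))"
        using S' by (intro sets_PiM_I_finite) auto
      ultimately have "(\<Inter>i\<in>{1..n}. A i) \<in>
          {(\<lambda>\<omega>. \<lambda>i\<in>{1..n}. Z i \<omega>) -` S \<inter> space M | S. S \<in> sets (PiM {1..n} (\<lambda>_. N))}"
        by blast
      moreover have "A 0 \<in> {Z 0 -` S \<inter> space M | S. S \<in> sets N}"
        using A by (auto simp: Pi_iff)
      ultimately have "prob ((\<Inter>i\<in>{1..n}. A i) \<inter> A 0) = prob (\<Inter>i\<in>{1..n}. A i) * prob (A 0)"
        by (rule indep_setD[OF S])
      moreover have "prob (\<Inter>i\<in>{1..n}. A i) = (\<Prod>i\<in>{1..n}. prob (A i))"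
        using iv A \<open>1 \<le> n\<close> unfolding indep_vars_def2 by (intro indep_setsD) (auto simp: Pi_iff)
      ultimately show "prob (\<Inter> (A ` {0..n})) = (\<Prod>j\<in>{0..n}. prob (A j))"
        unfolding split by (simp add: Int_commute mult.commute)
    qed
  qed auto
  then show ?thesis using rv by (auto simp: indep_vars_def2)
qed


text \<open>The training set comes without its noise variables; they are recovered as residuals. A
  training pair has the law of (X, Y), so point and residual have jointly the law of (X, E), and the
  residual inherits independence of its point and the moments of \<open>E\<close>. Residuals use
  \<open>f'\<close>, a Borel function agreeing with \<open>f\<close> on the cube, since
  \<open>f\<close> is unrestricted elsewhere.\<close>

lemma noisy_sample_of_model:
  fixes M :: "'w measure" and f f' :: "real^'d::finite \<Rightarrow> real"
  assumes model: "regression_model M f \<sigma> X E Y" and training: "training_set M n X Y Xs Ys"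
    and n: "1 \<le> n" and \<sigma>: "0 \<le> \<sigma>"
    and f' [measurable]: "f' \<in> borel_measurable borel" and ff': "\<And>x. x \<in> cbox 0 1 \<Longrightarrow> f' x = f x"
  defines "\<xi> \<equiv> \<lambda>i. if i = 0 then X else Xs i" and "y \<equiv> \<lambda>i. if i = 0 then Y else Ys i"
  shows "noisy_sample M n \<xi> (\<lambda>i \<omega>. y i \<omega> - f' (\<xi> i \<omega>)) \<sigma>"
proof -
  define \<eta> where "\<eta> = (\<lambda>i \<omega>. y i \<omega> - f' (\<xi> i \<omega>))"
  interpret prob_space M using model by (simp add: regression_model_def)
  have X: "\<And>\<omega>. \<omega> \<in> space M \<Longrightarrow> X \<omega> \<in> cbox 0 1" and lawX: "distr M borel X = unif"
    and gauss: "centered_gaussian M \<sigma> E" and XE: "independent_rvs M borel X borel E"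
    and Y: "\<And>\<omega>. \<omega> \<in> space M \<Longrightarrow> Y \<omega> = f (X \<omega>) + E \<omega>"
    using model by (auto simp: regression_model_def)
  note E = centered_gaussian_moments[OF gauss \<sigma>]
  let ?N = "borel \<Otimes>\<^sub>M borel :: ((real^'d) \<times> real) measure"
  define Z where "Z = (\<lambda>i \<omega>. (\<xi> i \<omega>, y i \<omega>))"
  have Z_simps: "Z 0 = (\<lambda>\<omega>. (X \<omega>, Y \<omega>))" "i \<in> {1..n} \<Longrightarrow> Z i = (\<lambda>\<omega>. (Xs i \<omega>, Ys i \<omega>))" for i
    by (auto simp: Z_def \<xi>_def y_def)
  have indZ: "indep_vars (\<lambda>_. ?N) Z {0..n}"
  proof (rule indep_vars_insert_vector[OF n])
    have "indep_vars (\<lambda>_. ?N) (\<lambda>i \<omega>. (Xs i \<omega>, Ys i \<omega>)) {1..n}"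
      using training by (simp add: training_set_def)
    then show "indep_vars (\<lambda>_. ?N) Z {1..n}"
      by (rule indep_vars_cong[THEN iffD1, rotated 3]) (auto simp: Z_simps)
    have "(\<lambda>\<omega>. \<lambda>i\<in>{1..n}. (Xs i \<omega>, Ys i \<omega>)) = (\<lambda>\<omega>. \<lambda>i\<in>{1..n}. Z i \<omega>)"
      by (intro ext) (auto simp: Z_simps restrict_def)
    then show "independent_rvs M (PiM {1..n} (\<lambda>_. ?N)) (\<lambda>\<omega>. \<lambda>i\<in>{1..n}. Z i \<omega>) ?N (Z 0)"
      using training by (simp add: training_set_def Z_simps(1))
  qed
  have Zm: "Z i \<in> measurable M ?N" if "i \<in> {0..n}" for i
    using indZ that by (auto simp: indep_vars_def)
  have lawZ: "distr M ?N (Z i) = distr M ?N (Z 0)" if "i \<in> {0..n}" for i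
    using training that by (cases "i = 0") (auto simp: training_set_def Z_simps)
  \<comment> \<open>One Borel map from (point, response) to (point, residual), which transports both
    independence across indices and equality of laws.\<close>
  define \<phi> where "\<phi> = (\<lambda>p :: (real^'d) \<times> real. (fst p, snd p - f' (fst p)))"
  have \<phi>: "\<phi> \<in> measurable ?N ?N" unfolding \<phi>_def by measurable
  define P where "P = (\<lambda>i \<omega>. \<phi> (Z i \<omega>))"
  have P_eq: "P i \<omega> = (\<xi> i \<omega>, \<eta> i \<omega>)" for i \<omega> by (simp add: P_def \<phi>_def Z_def \<eta>_def)
  have indP: "indep_vars (\<lambda>_. ?N) P {0..n}"
    unfolding P_def by (rule indep_vars_compose2[OF indZ \<phi>])
  have Pm: "P i \<in> measurable M ?N" if "i \<in> {0..n}" for i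
    using indP that by (auto simp: indep_vars_def)
  have lawP: "distr M ?N (P i) = distr M ?N (P 0)" if "i \<in> {0..n}" for i
  proof -
    have "distr M ?N (P j) = distr (distr M ?N (Z j)) ?N \<phi>" if "j \<in> {0..n}" for j
      using distr_distr[OF \<phi> Zm[OF that]] by (simp add: P_def comp_def)
    then show ?thesis using lawZ[OF that] that by simp
  qed
  have \<xi>m: "\<xi> i \<in> borel_measurable M" and \<eta>m: "\<eta> i \<in> borel_measurable M" if "i \<in> {0..n}" for i
    using measurable_compose[OF Pm[OF that] measurable_fst] measurable_compose[OF Pm[OF that] measurable_snd]
    by (simp_all add: P_eq)
  have law\<xi>: "distr M borel (\<xi> i) = distr M borel X" if "i \<in> {0..n}" for i
  proof -
    have "distr M borel (\<xi> j) = distr (distr M ?N (P j)) borel fst" if "j \<in> {0..n}" for j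
      using distr_distr[OF measurable_fst Pm[OF that]] by (simp add: P_eq comp_def)
    from this[OF that] this[of 0] lawP[OF that] show ?thesis by (simp add: \<xi>_def)
  qed
  \<comment> \<open>This holds surely, because \<open>X\<close> takes values in the cube surely and
    \<open>f'\<close> equals \<open>f\<close> there.\<close>
  have \<eta>0: "\<eta> 0 \<omega> = E \<omega>" if "\<omega> \<in> space M" for \<omega>
    using X[OF that] Y[OF that] ff' by (simp add: \<eta>_def \<xi>_def y_def)
  have law\<eta>: "distr M borel (\<eta> i) = distr M borel E" if "i \<in> {0..n}" for i
  proof -
    have "distr M borel (\<eta> j) = distr (distr M ?N (P j)) borel snd" if "j \<in> {0..n}" for j
      using distr_distr[OF measurable_snd Pm[OF that]] by (simp add: P_eq comp_def)
    from this[OF that] this[of 0] lawP[OF that] have "distr M borel (\<eta> i) = distr M borel (\<eta> 0)" by simp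
    also have "\<dots> = distr M borel E" by (rule distr_cong) (auto simp: \<eta>0)
    finally show ?thesis .
  qed
  have rect: "prob (\<xi> i -` S \<inter> space M \<inter> (\<eta> i -` T \<inter> space M))
      = prob (\<xi> i -` S \<inter> space M) * prob (\<eta> i -` T \<inter> space M)"
    if i: "i \<in> {0..n}" and ST: "S \<in> sets borel" "T \<in> sets borel" for i S T
  proof -
    have eq: "\<xi> j -` S \<inter> space M \<inter> (\<eta> j -` T \<inter> space M) = P j -` (S \<times> T) \<inter> space M" for j
      by (auto simp: P_eq)
    have rect_sets: "S \<times> T \<in> sets ?N" using ST by simp
    have "prob (P i -` (S \<times> T) \<inter> space M) = measure (distr M ?N (P i)) (S \<times> T)"
      using measure_distr[OF Pm[OF i] rect_sets] by simp
    also have "\<dots> = prob (P 0 -` (S \<times> T) \<inter> space M)"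
      using measure_distr[OF Pm[of 0] rect_sets] lawP[OF i] by simp
    also have "P 0 -` (S \<times> T) \<inter> space M = (X -` S \<inter> space M) \<inter> (E -` T \<inter> space M)"
      using \<eta>0 by (auto simp: P_eq \<xi>_def)
    also have "prob \<dots> = prob (X -` S \<inter> space M) * prob (E -` T \<inter> space M)"
      using XE ST unfolding independent_rvs_def by (intro indep_setD) auto
    also have "prob (X -` S \<inter> space M) = prob (\<xi> i -` S \<inter> space M)"
      using measure_distr[OF \<xi>m[OF i], of S] measure_distr[OF \<xi>m[of 0], of S] law\<xi>[OF i] ST
      by (simp add: \<xi>_def)
    also have "prob (E -` T \<inter> space M) = prob (\<eta> i -` T \<inter> space M)"
      using measure_distr[OF \<eta>m[OF i], of T] measure_distr[OF E(1), of T] law\<eta>[OF i] ST by simp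
    finally show ?thesis unfolding eq .
  qed
  let ?F = "\<lambda>(i, b). if b then {\<xi> i -` S \<inter> space M | S. S \<in> sets borel}
      else {\<eta> i -` S \<inter> space M | S. S \<in> sets borel}"
  \<comment> \<open>Two layers are multiplied: independence of the pairs across indices, and within
    each pair the product rule \<open>rect\<close>.\<close>
  have indF: "indep_sets ?F ({0..n} \<times> UNIV)"
  proof (subst indep_sets_finite)
    fix p assume "p \<in> {0..n} \<times> (UNIV :: bool set)"
    then show "?F p \<subseteq> events" "space M \<in> ?F p"
      using \<xi>m \<eta>m by (auto split: if_splits intro!: measurable_sets exI[of _ UNIV])
  next
    show "\<forall>A\<in>Pi ({0..n} \<times> UNIV) ?F. prob (\<Inter> (A ` ({0..n} \<times> UNIV))) = (\<Prod>p\<in>{0..n} \<times> UNIV. prob (A p))"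
    proof
      fix A assume A: "A \<in> Pi ({0..n} \<times> UNIV) ?F"
      have AT: "\<exists>S. A (i, True) = \<xi> i -` S \<inter> space M \<and> S \<in> sets borel" if "i \<in> {0..n}" for i
        using Pi_mem[OF A, of "(i, True)"] that by auto
      have AF: "\<exists>S. A (i, False) = \<eta> i -` S \<inter> space M \<and> S \<in> sets borel" if "i \<in> {0..n}" for i
        using Pi_mem[OF A, of "(i, False)"] that by auto
      have mem: "A (i, True) \<inter> A (i, False) \<in> {P i -` S \<inter> space M | S. S \<in> sets ?N}"
        and prod: "prob (A (i, True) \<inter> A (i, False)) = prob (A (i, True)) * prob (A (i, False))"
        if i: "i \<in> {0..n}" for i
      proof -
        obtain S T where S: "A (i, True) = \<xi> i -` S \<inter> space M" "S \<in> sets borel"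
          and T: "A (i, False) = \<eta> i -` T \<inter> space M" "T \<in> sets borel"
          using AT[OF i] AF[OF i] by blast
        have "A (i, True) \<inter> A (i, False) = P i -` (S \<times> T) \<inter> space M"
          unfolding S T by (auto simp: P_eq)
        moreover have "S \<times> T \<in> sets ?N" using S T by simp
        ultimately show "A (i, True) \<inter> A (i, False) \<in> {P i -` S \<inter> space M | S. S \<in> sets ?N}" by blast
        show "prob (A (i, True) \<inter> A (i, False)) = prob (A (i, True)) * prob (A (i, False))"
          unfolding S(1) T(1) by (rule rect[OF i S(2) T(2)])
      qed
      have "(\<Inter> (A ` ({0..n} \<times> UNIV))) = (\<Inter>i\<in>{0..n}. A (i, True) \<inter> A (i, False))"
        by (auto simp: UNIV_bool)
      also have "prob \<dots> = (\<Prod>i\<in>{0..n}. prob (A (i, True) \<inter> A (i, False)))"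
        using indP mem unfolding indep_vars_def2 by (intro indep_setsD) auto
      also have "\<dots> = (\<Prod>i\<in>{0..n}. \<Prod>b\<in>UNIV. prob (A (i, b)))"
        by (intro prod.cong refl) (simp add: prod UNIV_bool mult.commute)
      also have "\<dots> = (\<Prod>p\<in>{0..n} \<times> UNIV. prob (A p))"
        by (simp add: prod.cartesian_product split_def)
      finally show "prob (\<Inter> (A ` ({0..n} \<times> UNIV))) = (\<Prod>p\<in>{0..n} \<times> UNIV. prob (A p))" .
    qed
  qed auto
  have "noisy_sample M n \<xi> \<eta> \<sigma>"
  proof
    show "indep_sets ?F ({0..n} \<times> UNIV)" by (rule indF)
  next
    fix i assume "i \<le> n"
    then have i: "i \<in> {0..n}" by simp
    show "\<xi> i \<in> borel_measurable M" "\<eta> i \<in> borel_measurable M" using \<xi>m \<eta>m i by auto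
    show "distr M borel (\<xi> i) = unif" using law\<xi>[OF i] lawX by simp
    have "integrable M (\<lambda>\<omega>. (\<eta> i \<omega>)\<^sup>2) \<longleftrightarrow> integrable (distr M borel (\<eta> i)) (\<lambda>x. x\<^sup>2)"
      using \<eta>m[OF i] by (subst integrable_distr_eq) auto
    also have "\<dots> \<longleftrightarrow> integrable M (\<lambda>\<omega>. (E \<omega>)\<^sup>2)"
      unfolding law\<eta>[OF i] using E(1) by (subst integrable_distr_eq) auto
    finally show "integrable M (\<lambda>\<omega>. (\<eta> i \<omega>)\<^sup>2)" using E(2) by simp
    have tr: "expectation (\<lambda>\<omega>. u (\<eta> i \<omega>)) = expectation (\<lambda>\<omega>. u (E \<omega>))"
      if "u \<in> borel_measurable borel" for u :: "real \<Rightarrow> real"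
      using integral_distr[OF \<eta>m[OF i] that] integral_distr[OF E(1) that] law\<eta>[OF i] by simp
    show "expectation (\<eta> i) = 0" using tr[of "\<lambda>x. x"] E(3) by simp
    show "expectation (\<lambda>\<omega>. (\<eta> i \<omega>)\<^sup>2) = \<sigma>\<^sup>2" using tr[of "\<lambda>x. x\<^sup>2"] E(4) by simp
  next
    fix \<omega> assume "\<omega> \<in> space M"
    then show "\<xi> 0 \<omega> \<in> cbox 0 1" using X by (simp add: \<xi>_def)
  qed
  then show ?thesis unfolding \<eta>_def .
qed


section \<open>Rates in \<open>n\<close> and the conclusion\<close>

lemma exp_decay_le_powr:
  fixes q a C :: real
  assumes "0 < q" "q < 1"
  shows "\<forall>\<^sub>F n in sequentially. C * q ^ nat \<lfloor>log 2 (real n)\<rfloor> \<le> log 2 (real n) powr (- a)"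
proof -
  define s where "s = - ln q"
  have s: "0 < s" using assms by (simp add: s_def)
  \<comment> \<open>The floor in the depth costs at most one level, hence the shift to x -
    1.\<close>
  have "((\<lambda>x. \<bar>C\<bar> * exp (- s * (x - 1)) * x powr a) \<longlongrightarrow> 0) at_top"
    using s by real_asymp
  then have "\<forall>\<^sub>F x in at_top. \<bar>C\<bar> * exp (- s * (x - 1)) * x powr a < 1"
    by (rule order_tendstoD) simp
  moreover have "filterlim (\<lambda>n. log 2 (real n)) at_top sequentially"
    by real_asymp
  ultimately have "\<forall>\<^sub>F n in sequentially.
      \<bar>C\<bar> * exp (- s * (log 2 (real n) - 1)) * log 2 (real n) powr a < 1"
    by (rule eventually_compose_filterlim)
  then show ?thesis using eventually_ge_at_top[of 2]
  proof eventually_elim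
    case (elim n)
    define l where "l = log 2 (real n)"
    have l: "1 \<le> l" using elim by (simp add: l_def)
    have "l - 1 \<le> real (nat \<lfloor>l\<rfloor>)" using l by linarith
    then have "exp (- s * real (nat \<lfloor>l\<rfloor>)) \<le> exp (- s * (l - 1))" using s by simp
    moreover have "q ^ nat \<lfloor>l\<rfloor> = exp (- s * real (nat \<lfloor>l\<rfloor>))"
      using assms by (simp add: s_def exp_of_nat2_mult mult.commute)
    ultimately have "C * q ^ nat \<lfloor>l\<rfloor> \<le> \<bar>C\<bar> * exp (- s * (l - 1))"
      using assms by (intro mult_mono) auto
    also have "\<dots> = (\<bar>C\<bar> * exp (- s * (l - 1)) * l powr a) * l powr (- a)"
      using l by (simp add: powr_minus)
    also have "\<dots> \<le> 1 * l powr (- a)"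
      using elim unfolding l_def[symmetric] by (intro mult_right_mono) auto
    finally show ?case by (simp add: l_def)
  qed
qed

text \<open>The depth plus one is at most d (k div d + 1), so \<open>Suc (k div d)\<close> is at
  least l / d; the power of \<open>d\<close> in the constant pays for this division. As
  \<open>l\<close> is at least 1, the exponent may be weakened to any such \<open>a\<close>.\<close>

lemma kernel_decay_le_powr:
  assumes "0 < d" "1 \<le> l" "a \<le> (real d - 1) / 2"
  shows "kernel_decay d (nat \<lfloor>l\<rfloor>) \<le> kernel_const d * real d powr ((real d - 1) / 2) * l powr (- a)"
proof -
  let ?k = "nat \<lfloor>l\<rfloor>" and ?e = "(real d - 1) / 2"
  have e: "0 \<le> ?e" using assms by simp
  have "l \<le> real ?k + 1" using assms by linarith
  also have "?k + 1 \<le> d * Suc (?k div d)"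
    using dividend_less_times_div[of d ?k] assms by simp
  then have "real ?k + 1 \<le> real d * real (Suc (?k div d))"
    by (metis of_nat_le_iff of_nat_mult of_nat_add of_nat_1)
  finally have "l / d \<le> real (Suc (?k div d))" using assms by (simp add: divide_le_eq mult.commute)
  then have "real (Suc (?k div d)) powr (- ?e) \<le> (l / d) powr (- ?e)"
    using assms e by (intro powr_mono2') auto
  also have "\<dots> = real d powr ?e * l powr (- ?e)"
    using assms by (simp add: powr_divide powr_minus_divide)
  also have "\<dots> \<le> real d powr ?e * l powr (- a)"
    using assms by (intro mult_left_mono powr_mono) auto
  finally have "real (Suc (?k div d)) powr (- ?e) \<le> real d powr ?e * l powr (- a)" .
  moreover have "0 \<le> kernel_const d"
    unfolding kernel_const_def by (intro zero_le_power divide_nonneg_nonneg) auto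
  ultimately show ?thesis unfolding kernel_decay_def by (simp add: mult_left_mono mult.assoc)
qed

text \<open>On the compact cube \<open>f\<close> is continuous, so its supremum there is a genuine
  bound. Extending it by zero gives a Borel function bounded by \<open>B\<close> everywhere, as
  \<open>kerf_risk\<close> requires.\<close>

lemma excess_risk_le:
  fixes M :: "'w measure" and f :: "real^'d::finite \<Rightarrow> real"
  assumes model: "regression_model M f \<sigma> X E Y" and training: "training_set M n X Y Xs Ys"
    and n: "2 ^ k \<le> n" and \<sigma>: "0 \<le> \<sigma>"
    and lip: "L-lipschitz_on (cbox 0 1) f" and B: "(SUP x\<in>cbox 0 1. \<bar>f x\<bar>) = B"
  defines "F \<equiv> \<lambda>\<omega>. infinite_kerf k n (\<lambda>i. Xs i \<omega>) (\<lambda>i. Ys i \<omega>)"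
  shows "integrable M (squared_error f X F)"
    and "excess_risk M f X F \<le> (16 * \<sigma>\<^sup>2 + 32 * B\<^sup>2) * kernel_decay CARD('d) k
      + 4 * L\<^sup>2 * (CARD('d) * (1 - 3 / (4 * real CARD('d))) ^ k)"
proof -
  have cont: "continuous_on (cbox 0 1) f"
    using lip by (rule lipschitz_on_continuous_on)
  define f' where "f' = (\<lambda>x. indicator (cbox 0 1) x *\<^sub>R f x)"
  have f': "f' \<in> borel_measurable borel"
    unfolding f'_def by (rule borel_measurable_continuous_on_indicator[OF _ cont]) simp
  have ff': "f' x = f x" if "x \<in> cbox 0 1" for x using that by (simp add: f'_def)
  have bdd: "bdd_above ((\<lambda>x. \<bar>f x\<bar>) ` cbox 0 1)"
    by (intro compact_imp_bounded[THEN bounded_imp_bdd_above] compact_continuous_image continuous_intros cont) simp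
  have fB: "\<bar>f x\<bar> \<le> B" if "x \<in> cbox 0 1" for x
    unfolding B[symmetric] by (rule cSUP_upper[OF that bdd])
  have "(0 :: real^'d) \<in> cbox 0 1" by (simp add: mem_box_cart)
  from fB[OF this] have "0 \<le> B" by linarith
  then have f'B: "\<bar>f' x\<bar> \<le> B" for x
    using fB by (cases "x \<in> cbox 0 1") (auto simp: f'_def)
  have f'L: "\<bar>f' x - f' z\<bar> \<le> L * norm (x - z)" if "x \<in> cbox 0 1" "z \<in> cbox 0 1" for x z
    using lipschitz_onD[OF lip that] that by (simp add: ff' dist_norm)
  have n1: "1 \<le> n" using n one_le_power[of "2 :: nat" k] by linarith
  interpret S: noisy_sample M n "\<lambda>i. if i = 0 then X else Xs i"
    "\<lambda>i \<omega>. (if i = 0 then Y else Ys i) \<omega> - f' ((if i = 0 then X else Xs i) \<omega>)" \<sigma>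
    by (rule noisy_sample_of_model[OF model training n1 \<sigma> f' ff'])
  have X: "X \<omega> \<in> cbox 0 1" if "\<omega> \<in> space M" for \<omega>
    using S.\<xi>_0[OF that] by simp
  \<comment> \<open>Responses are rewritten as \<open>f'\<close> plus residual, the form in which
    \<open>kerf_risk\<close> takes its data.\<close>
  have eq: "squared_error f X F \<omega> = (infinite_kerf k n (\<lambda>i. (if i = 0 then X else Xs i) \<omega>)
      (\<lambda>i. f' ((if i = 0 then X else Xs i) \<omega>) + ((if i = 0 then Y else Ys i) \<omega> - f' ((if i = 0 then X else Xs i) \<omega>)))
      ((if 0 = (0::nat) then X else Xs 0) \<omega>) - f' ((if 0 = (0::nat) then X else Xs 0) \<omega>))\<^sup>2" if "\<omega> \<in> space M" for \<omega>
  proof -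
    have "infinite_kerf k n (\<lambda>i. (if i = 0 then X else Xs i) \<omega>)
      (\<lambda>i. f' ((if i = 0 then X else Xs i) \<omega>) + ((if i = 0 then Y else Ys i) \<omega> - f' ((if i = 0 then X else Xs i) \<omega>)))
      (X \<omega>) = F \<omega> (X \<omega>)"
      unfolding infinite_kerf_def F_def by (intro arg_cong2[of _ _ _ _ "(/)"] sum.cong refl) auto
    then show ?thesis using X[OF that] by (simp add: squared_error_def ff')
  qed
  note risk = S.kerf_risk[OF _ n f' f'B f'L]
  show "integrable M (squared_error f X F)"
    using risk(1) n1 by (subst Bochner_Integration.integrable_cong[OF refl eq]) auto
  show "excess_risk M f X F \<le> (16 * \<sigma>\<^sup>2 + 32 * B\<^sup>2) * kernel_decay CARD('d) k
      + 4 * L\<^sup>2 * (CARD('d) * (1 - 3 / (4 * real CARD('d))) ^ k)"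
    unfolding excess_risk_def
    using risk(2) n1 by (subst Bochner_Integration.integral_cong[OF refl eq]) auto
qed

text \<open>The order of quantifiers carries content: \<open>C\<close> depends on \<sigma>,
  \<open>B\<close> and the dimension only, whereas the threshold on \<open>n\<close> may depend on
  \<open>L\<close> and \<open>f\<close> but is uniform over probability spaces and samples.\<close>

theorem theorem4p1:
  fixes \<sigma> B :: real
  assumes "CARD('d::finite) > 5" and "\<sigma> \<ge> 0"
  shows "\<exists>C>0. \<forall>(L::real) (f :: real^'d \<Rightarrow> real).
    L-lipschitz_on (cbox 0 1) f \<and> (SUP x\<in>cbox 0 1. \<bar>f x\<bar>) = B \<longrightarrow>
    (\<forall>\<^sub>F n in sequentially. \<forall>(M :: 'w measure) X E Y Xs Ys.
       regression_model M f \<sigma> X E Y \<and> training_set M n X Y Xs Ys \<longrightarrow>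
       (let F = (\<lambda>\<omega>. infinite_kerf (nat \<lfloor>log 2 (real n)\<rfloor>) n (\<lambda>i. Xs i \<omega>) (\<lambda>i. Ys i \<omega>));
            d = real CARD('d)
        in integrable M (squared_error f X F) \<and>
           excess_risk M f X F
             \<le> 8 * L\<^sup>2 * d\<^sup>2 * real n powr (2 * log 2 (1 - 1 / d))
               + C * log 2 (real n) powr (- ((d - 5) / 6))
                   * log 2 (log 2 (real n)) powr (d / 3)))"
proof -
  define d where "d = real CARD('d)"
  define a where "a = (d - 5) / 6"
  have d: "6 \<le> d" using assms(1) by (simp add: d_def)
  define A where "A = kernel_const CARD('d) * d powr ((d - 1) / 2)"
  have A: "0 \<le> A" unfolding A_def kernel_const_def
    by (intro mult_nonneg_nonneg zero_le_power divide_nonneg_nonneg) auto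
  define V where "V = 16 * \<sigma>\<^sup>2 + 32 * B\<^sup>2"
  have V: "0 \<le> V" by (simp add: V_def)
  \<comment> \<open>The part \<open>V * A\<close> pays for noise and denominator deviation. The
    added 1 pays for the bias, whose factor L^2 is absorbed by taking \<open>n\<close>
    large.\<close>
  define C where "C = V * A + 1"
  have C: "0 < C" using mult_nonneg_nonneg[OF V A] by (simp add: C_def)
  have "\<forall>\<^sub>F n in sequentially. \<forall>(M :: 'w measure) X E Y Xs Ys.
       regression_model M f \<sigma> X E Y \<and> training_set M n X Y Xs Ys \<longrightarrow>
       (let F = (\<lambda>\<omega>. infinite_kerf (nat \<lfloor>log 2 (real n)\<rfloor>) n (\<lambda>i. Xs i \<omega>) (\<lambda>i. Ys i \<omega>))
        in integrable M (squared_error f X F) \<and>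
           excess_risk M f X F
             \<le> 8 * L\<^sup>2 * d\<^sup>2 * real n powr (2 * log 2 (1 - 1 / d))
               + C * log 2 (real n) powr (- a) * log 2 (log 2 (real n)) powr (d / 3))"
    if lip: "L-lipschitz_on (cbox 0 1) f" and B: "(SUP x\<in>cbox 0 1. \<bar>f x\<bar>) = B"
    for L and f :: "real^'d \<Rightarrow> real"
  proof -
    have "0 < 1 - 3 / (4 * d)" "1 - 3 / (4 * d) < 1" using d by auto
    \<comment> \<open>From n = 4 on, the iterated logarithm is at least 1, so its power can be
      inserted as a factor.\<close>
    from exp_decay_le_powr[OF this, of "4 * L\<^sup>2 * d" a] eventually_ge_at_top[of 4]
    show ?thesis
    proof eventually_elim
      case (elim n)
      define l where "l = log 2 (real n)"
      define k where "k = nat \<lfloor>l\<rfloor>"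
      have l: "2 \<le> l" using elim by (simp add: l_def le_log_iff)
      have "real (2 ^ k) = 2 powr real k" by (simp add: powr_realpow)
      also have "\<dots> \<le> 2 powr l" using l by (intro powr_mono) (auto simp: k_def)
      also have "\<dots> = real n" using elim by (simp add: l_def)
      finally have k: "2 ^ k \<le> n" by (simp only: of_nat_le_iff)
      have "1 \<le> log 2 l" using l by (simp add: le_log_iff)
      then have ll: "1 \<le> log 2 l powr (d / 3)" using d by (intro ge_one_powr_ge_zero) auto
      \<comment> \<open>The exponent (d - 1)/2 of the kernel decay exceeds (d - 5)/6.\<close>
      have "V * kernel_decay CARD('d) k \<le> V * (A * l powr (- a))"
        using kernel_decay_le_powr[of "CARD('d)" l a] l d V
        by (intro mult_left_mono) (auto simp: k_def A_def a_def d_def)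
      moreover have "4 * L\<^sup>2 * (d * (1 - 3 / (4 * d)) ^ k) \<le> l powr (- a)"
        using elim(1) unfolding l_def[symmetric] k_def[symmetric] by (simp add: mult.assoc)
      ultimately have "V * kernel_decay CARD('d) k + 4 * L\<^sup>2 * (d * (1 - 3 / (4 * d)) ^ k)
          \<le> C * l powr (- a)" by (simp add: C_def algebra_simps)
      also have "\<dots> \<le> C * l powr (- a) * log 2 l powr (d / 3)"
        using mult_left_mono[OF ll, of "C * l powr (- a)"] C by simp
      \<comment> \<open>The polynomial term is nonnegative; the bias is already contained in the
        logarithmic term.\<close>
      also have "\<dots> \<le> 8 * L\<^sup>2 * d\<^sup>2 * real n powr (2 * log 2 (1 - 1 / d)) + \<dots>" by simp
      finally have le: "V * kernel_decay CARD('d) k + 4 * L\<^sup>2 * (d * (1 - 3 / (4 * d)) ^ k)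
        \<le> 8 * L\<^sup>2 * d\<^sup>2 * real n powr (2 * log 2 (1 - 1 / d)) + C * l powr (- a) * log 2 l powr (d / 3)" .
      show ?case unfolding Let_def l_def[symmetric] k_def[symmetric]
      proof (intro allI impI, elim conjE)
        fix M :: "'w measure" and X E Y Xs Ys
        assume "regression_model M f \<sigma> X E Y" "training_set M n X Y Xs Ys"
        note R = excess_risk_le[OF this k assms(2) lip B]
        show "integrable M (squared_error f X (\<lambda>\<omega>. infinite_kerf k n (\<lambda>i. Xs i \<omega>) (\<lambda>i. Ys i \<omega>))) \<and>
          excess_risk M f X (\<lambda>\<omega>. infinite_kerf k n (\<lambda>i. Xs i \<omega>) (\<lambda>i. Ys i \<omega>))
            \<le> 8 * L\<^sup>2 * d\<^sup>2 * real n powr (2 * log 2 (1 - 1 / d)) + C * l powr (- a) * log 2 l powr (d / 3)"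
          using R(1) order.trans[OF R(2)[folded d_def V_def] le] by blast
      qed
    qed
  qed
  with C show ?thesis unfolding Let_def a_def d_def by blast
qed

end
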